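(* Let $S[1..r]$ be a string generated under Szpankowski's A2 model. Let $T$ be formed by concatenating $d$ copies of $S$, each terminated with the special symbol $\$$, and then carrying out $s$ edits (symbol insertions, deletions, or substitutions) at arbitrary positions in $T$ (excluding the $\$$'s). Then, almost surely, the interleaved LCP array $\mathsf{ILCP}$ of $T$ is formed by $$\rho \le r + O(s\lg(r+s))$$ runs of equal values.
   Context: Strings are indexed from 1, and $\lg$ is the base-2 logarithm. Szpankowski's A2 model: the string is a prefix of length $r$ of a stationary ergodic sequence $(X_k)$ over a finite alphabet (not containing $\$$) in which the statistical dependence of a symbol on previous ones tends to zero as the distance to them tends to infinity. Formally (strong mixing): there is a function $\alpha$ with $\alpha(g)\to 0$ as $g\to\infty$ such that, for every $m$, every $g\ge 1$, every event $A$ determined by $(X_k)_{k\le m}$ and every event $B$ determined by $(X_k)_{k\ge m+g}$, $(1-\alpha(g))\Pr(A)\Pr(B)\le \Pr(A\cap B)\le (1+\alpha(g))\Pr(A)\Pr(B)$. The model includes Bernoulli sources, stationary Markov chains, and $k$th order models for fixed $k$. Almost surely: a sequence $X_n$ tends to a value $\beta$ almost surely if, for every $\epsilon>0$, $\lim_{n\to\infty}\sup_{N>n}\Pr(|X_N/\beta-1|>\epsilon)=0$. Asymptotic statements here are as the length $r$ of the base string grows. After the edits, $T=S_1\cdots S_d$, where the documents $S_j$ are the edited copies, each ending with its $\$$; $\$$ is lexicographically smaller than every other symbol, and the edits neither insert nor remove $\$$ symbols. Let $n=|T|$. The suffix array $\mathsf{SA}[1..n]$ of $T$ is the permutation of $\{1,\dots,n\}$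 with $T[\mathsf{SA}[i]..n] < T[\mathsf{SA}[i+1]..n]$ lexicographically for all $1\le i<n$. The suffix array $\mathsf{SA}_{X}$ of a string $X$ is defined in the same way. The document array $\mathsf{DA}[1..n]$ is defined by letting $\mathsf{DA}[i]$ be the index $j$ of the document $S_j$ containing position $\mathsf{SA}[i]$ of $T$. For a sequence $X$, $\mathsf{rank}_c(X,i)$ is the number of occurrences of $c$ in $X[1..i]$. The longest-common-prefix array $\mathsf{LCP}_X[1..|X|]$ of a string $X$ has $\mathsf{LCP}_X[1]=0$ and, for $2\le i\le |X|$, $\mathsf{LCP}_X[i]$ is the length of the longest common prefix of $X[\mathsf{SA}_X[i-1]..|X|]$ and $X[\mathsf{SA}_X[i]..|X|]$. The interleaved LCP array of $T$ is defined for $1\le i\le n$ by $$\mathsf{ILCP}[i] = \mathsf{LCP}_{S_{\mathsf{DA}[i]}}\bigl[\mathsf{rank}_{\mathsf{DA}[i]}(\mathsf{DA},i)\bigr].$$ A run is a maximal interval of consecutive positions of $\mathsf{ILCP}$ holding equal values.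
   Formalization: The source is additionally assumed not to be almost surely a single constant symbol; for S = a^r, d = 2 and one substitution of the middle symbol of a copy by b > a, ILCP has about 3r/2 runs, so the claim as stated fails. *)

theory Defs
  imports "HOL-Probability.Probability" "HOL-Library.Sublist"
    "HOL-Library.List_Lexorder" "HOL-Library.Option_ord"
begin

section \<open>Suffix arrays, document arrays and the interleaved LCP array\<close>

text \<open>
  Symbols of texts have type \<open>'a option\<close> where \<open>'a\<close> is the finite ordered alphabet of the
  source; \<open>None\<close> is the terminator, which is below every \<open>Some c\<close> in the order of
  \<open>Option_ord\<close>. The order on strings is the lexicographic one of \<open>List_Lexorder\<close>.
  Arrays are lists; positions and array entries are 1-based.
\<close>

abbreviation nth1 :: "'b list \<Rightarrow> nat \<Rightarrow> 'b"  (infixl "!\<^sub>1" 100) where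
  "xs !\<^sub>1 i \<equiv> xs ! (i - 1)"

abbreviation suffix_from :: "nat \<Rightarrow> 'b list \<Rightarrow> 'b list" where
  "suffix_from p X \<equiv> drop (p - 1) X"

definition is_suffix_array :: "'b::linorder list \<Rightarrow> nat list \<Rightarrow> bool" where
  "is_suffix_array X sa \<longleftrightarrow>
     distinct sa \<and> set sa = {1..length X} \<and>
     (\<forall>i. 1 \<le> i \<and> i < length X \<longrightarrow>
        suffix_from (sa !\<^sub>1 i) X < suffix_from (sa !\<^sub>1 (i + 1)) X)"

definition suffix_array :: "'b::linorder list \<Rightarrow> nat list" where
  "suffix_array X = (THE sa. is_suffix_array X sa)"

definition lcp_array :: "'b::linorder list \<Rightarrow> nat list" where
  "lcp_array X = map (\<lambda>i. if i = 1 then 0 else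
       length (longest_common_prefix
         (suffix_from (suffix_array X !\<^sub>1 (i - 1)) X)
         (suffix_from (suffix_array X !\<^sub>1 i) X)))
     [1..<length X + 1]"

definition rank :: "'b \<Rightarrow> 'b list \<Rightarrow> nat \<Rightarrow> nat" where
  "rank c xs i = count_list (take i xs) c"

text \<open>Splitting a text after each terminator. A trailing piece without terminator would form a
  document of its own; it does not occur for the texts considered below.\<close>

fun documents :: "'a option list \<Rightarrow> 'a option list list" where
  "documents [] = []"
| "documents (None # xs) = [None] # documents xs"
| "documents (Some c # xs) =
     (case documents xs of [] \<Rightarrow> [[Some c]] | D # Ds \<Rightarrow> (Some c # D) # Ds)"

definition document_of :: "'a option list \<Rightarrow> nat \<Rightarrow> nat" where
  "document_of T p = (THE j. 1 \<le> j \<and> j \<le> length (documents T) \<and>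
     length (concat (take (j - 1) (documents T))) < p \<and>
     p \<le> length (concat (take j (documents T))))"

definition document_array :: "'a::linorder option list \<Rightarrow> nat list" where
  "document_array T = map (document_of T) (suffix_array T)"

definition ilcp :: "'a::linorder option list \<Rightarrow> nat list" where
  "ilcp T = map (\<lambda>i. let j = document_array T !\<^sub>1 i in
       lcp_array (documents T !\<^sub>1 j) !\<^sub>1 rank j (document_array T) i)
     [1..<length T + 1]"

definition constant_between :: "'b list \<Rightarrow> nat \<Rightarrow> nat \<Rightarrow> bool" where
  "constant_between xs i j \<longleftrightarrow>
     1 \<le> i \<and> i \<le> j \<and> j \<le> length xs \<and> (\<forall>k\<in>{i..j}. xs !\<^sub>1 k = xs !\<^sub>1 i)"

definition is_run :: "'b list \<Rightarrow> nat \<Rightarrow> nat \<Rightarrow> bool" where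
  "is_run xs i j \<longleftrightarrow> constant_between xs i j \<and>
     (\<forall>i' j'. i' \<le> i \<and> j \<le> j' \<and> constant_between xs i' j' \<longrightarrow> i' = i \<and> j' = j)"

definition num_runs :: "'b list \<Rightarrow> nat" where
  "num_runs xs = card {(i, j). is_run xs i j}"

section \<open>Edited collections\<close>

definition copies :: "nat \<Rightarrow> 'a list \<Rightarrow> 'a option list" where
  "copies d S = concat (replicate d (map Some S @ [None]))"

text \<open>In an insertion the part \<open>v\<close> after the new symbol must be nonempty, as otherwise a symbol
  would be placed behind the last terminator, outside of all documents.\<close>

inductive edit :: "'a option list \<Rightarrow> 'a option list \<Rightarrow> bool" where
  insertion: "v \<noteq> [] \<Longrightarrow> edit (u @ v) (u @ Some b # v)"
| deletion: "edit (u @ Some a # v) (u @ v)"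
| substitution: "edit (u @ Some a # v) (u @ Some b # v)"

section \<open>Strongly mixing sources\<close>

abbreviation seq_space :: "(nat \<Rightarrow> 'a) measure" where
  "seq_space \<equiv> PiM UNIV (\<lambda>_. count_space UNIV)"

definition process_law :: "'w measure \<Rightarrow> (nat \<Rightarrow> 'w \<Rightarrow> 'a) \<Rightarrow> (nat \<Rightarrow> 'a) measure" where
  "process_law M X = distr M seq_space (\<lambda>\<omega> k. X k \<omega>)"

definition stationary :: "'w measure \<Rightarrow> (nat \<Rightarrow> 'w \<Rightarrow> 'a) \<Rightarrow> bool" where
  "stationary M X \<longleftrightarrow> process_law M (\<lambda>k. X (Suc k)) = process_law M X"

definition ergodic :: "'w measure \<Rightarrow> (nat \<Rightarrow> 'w \<Rightarrow> 'a) \<Rightarrow> bool" where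
  "ergodic M X \<longleftrightarrow>
     (\<forall>B\<in>sets seq_space. (\<lambda>x k. x (Suc k)) -` B = B \<longrightarrow>
        measure (process_law M X) B \<in> {0, 1})"

definition determined_events ::
    "'w measure \<Rightarrow> (nat \<Rightarrow> 'w \<Rightarrow> 'a) \<Rightarrow> nat set \<Rightarrow> 'w set set" where
  "determined_events M X I =
     sigma_sets (space M) (\<Union>k\<in>I. {X k -` A \<inter> space M | A. A \<in> UNIV})"

definition strongly_mixing :: "'w measure \<Rightarrow> (nat \<Rightarrow> 'w \<Rightarrow> 'a) \<Rightarrow> bool" where
  "strongly_mixing M X \<longleftrightarrow>
     (\<exists>\<alpha> :: nat \<Rightarrow> real. \<alpha> \<longlonglongrightarrow> 0 \<and>
       (\<forall>m g. \<forall>A\<in>determined_events M X {..m}. \<forall>B\<in>determined_events M X {m + g..}.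
          g \<ge> 1 \<longrightarrow>
            (1 - \<alpha> g) * measure M A * measure M B \<le> measure M (A \<inter> B) \<and>
            measure M (A \<inter> B) \<le> (1 + \<alpha> g) * measure M A * measure M B))"

locale A2_source = prob_space M
  for M :: "'w measure" and X :: "nat \<Rightarrow> 'w \<Rightarrow> 'a::finite" +
  assumes measurable_X: "\<And>k. X k \<in> measurable M (count_space UNIV)"
    and stationary: "stationary M X"
    and ergodic: "ergodic M X"
    and strongly_mixing: "strongly_mixing M X"

definition source_prefix :: "(nat \<Rightarrow> 'w \<Rightarrow> 'a) \<Rightarrow> nat \<Rightarrow> 'w \<Rightarrow> 'a list" where
  "source_prefix X r \<omega> = map (\<lambda>k. X k \<omega>) [0..<r]"

text \<open>Convergence in probability, uniformly along tails: the probability that \<open>E N\<close> fails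
  vanishes. The failure sets have to be measurable for this to be meaningful; see
  \<open>prefix_event_measurable\<close> for events determined by a prefix of a source.\<close>

definition asymptotically_almost_surely ::
    "'w measure \<Rightarrow> (nat \<Rightarrow> 'w \<Rightarrow> bool) \<Rightarrow> bool" where
  "asymptotically_almost_surely M E \<longleftrightarrow>
     (\<lambda>n. SUP N\<in>{n<..}. measure M {\<omega> \<in> space M. \<not> E N \<omega>}) \<longlonglongrightarrow> 0"

section \<open>Consistency of the definitions\<close>

lemma is_suffix_array_sort_key:
  "is_suffix_array X sa \<longleftrightarrow> sa = sort_key (\<lambda>p. suffix_from p X) [1..<length X + 1]"
proof -
  let ?f = "\<lambda>p. suffix_from p X"
  define s where "s = sort_key ?f [1..<length X + 1]"
  have inj: "inj_on ?f {1..length X}"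
  proof (rule inj_onI)
    fix p q assume pq: "p \<in> {1..length X}" "q \<in> {1..length X}" and "?f p = ?f q"
    then have "length (?f p) = length (?f q)" by presburger
    then have "length X - (p - 1) = length X - (q - 1)" by simp
    with pq show "p = q" unfolding atLeastAtMost_iff by linarith
  qed
  have set_s: "set s = {1..length X}" by (auto simp: s_def)
  have len_s: "length s = length X" and dist_s: "distinct s" by (auto simp: s_def simp del: upt_Suc)
  have "sorted (map ?f s)" unfolding s_def by (rule sorted_sort_key)
  then have strict: "sorted_wrt (<) (map ?f s)"
    using inj set_s dist_s by (simp add: strict_sorted_iff distinct_map)
  have A: "is_suffix_array X s"
    unfolding is_suffix_array_def
  proof (intro conjI allI impI)
    fix i assume i: "1 \<le> i \<and> i < length X"
    then have "i - 1 < length s" "i < length s" using len_s by auto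
    with i show "?f (s !\<^sub>1 i) < ?f (s !\<^sub>1 (i + 1))"
      using sorted_wrt_nth_less[OF strict, of "i - 1" i] by simp
  qed (use set_s dist_s in auto)
  moreover have "sa = s" if sa: "is_suffix_array X sa"
  proof -
    have d: "distinct sa" and ssa: "set sa = {1..length X}"
      using sa by (auto simp: is_suffix_array_def)
    have len: "length sa = length X" using distinct_card[OF d] ssa by simp
    have "sorted_wrt (<) (map ?f sa)"
      unfolding sorted_wrt_iff_nth_Suc_transp[OF transp_on_less]
    proof (intro allI impI)
      fix i assume "Suc i < length (map ?f sa)"
      then show "map ?f sa ! i < map ?f sa ! Suc i"
        using sa len unfolding is_suffix_array_def by (auto dest!: spec[of _ "Suc i"])
    qed
    then have "map ?f sa = map ?f s"
      using strict set_s by (intro strict_sorted_equal) (simp_all add: ssa)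
    then show "sa = s"
      using inj ssa set_s by (auto intro: map_inj_on)
  qed
  ultimately show ?thesis unfolding s_def by blast
qed

lemma is_suffix_array_suffix_array: "is_suffix_array X (suffix_array X)"
  unfolding suffix_array_def by (rule theI) (auto simp: is_suffix_array_sort_key)

lemma concat_documents: "concat (documents T) = T"
  by (induction T rule: documents.induct) (auto split: list.splits)

lemma documents_append_terminated:
  "documents (map Some w @ None # T) = (map Some w @ [None]) # documents T"
  by (induction w) auto

lemma documents_concat_terminated:
  "documents (concat (map (\<lambda>w. map Some w @ [None]) ws)) = map (\<lambda>w. map Some w @ [None]) ws"
  by (induction ws) (auto simp: documents_append_terminated)

lemma edit_terminated:
  assumes "edit (concat (map (\<lambda>w. map Some w @ [None]) ws)) T"
  shows "\<exists>ws'. length ws' = length ws \<and> T = concat (map (\<lambda>w. map Some w @ [None]) ws')"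
proof -
  have split: "\<exists>ws'. length ws' = length (filter (\<lambda>x. x = None) T) \<and>
      T = concat (map (\<lambda>w. map Some w @ [None]) ws')"
    if "T = [] \<or> last T = None" for T :: "'a option list"
    using that
  proof (induction T rule: documents.induct)
    case (2 xs)
    then obtain ws' where "length ws' = length (filter (\<lambda>x. x = None) xs)"
      "xs = concat (map (\<lambda>w. map Some w @ [None]) ws')" by (auto split: if_splits)
    then show ?case by (intro exI[of _ "[] # ws'"]) auto
  next
    case (3 c xs)
    then have ne: "xs \<noteq> []" "last xs = None" by (auto split: if_splits)
    with 3 obtain ws' where w: "length ws' = length (filter (\<lambda>x. x = None) xs)"
      "xs = concat (map (\<lambda>w. map Some w @ [None]) ws')" by auto
    with ne obtain w ws'' where "ws' = w # ws''" by (cases ws') auto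
    with w show ?case by (intro exI[of _ "(c # w) # ws''"]) auto
  qed simp
  let ?T = "concat (map (\<lambda>w. map Some w @ [None]) ws)"
  have fil: "length (filter (\<lambda>x. x = None) ?T) = length ws"
    by (induction ws) (auto simp: filter_map o_def)
  have lst: "?T = [] \<or> last ?T = None"
    by (induction ws) auto
  from assms have "length (filter (\<lambda>x. x = None) T) = length (filter (\<lambda>x. x = None) ?T) \<and>
      (T = [] \<or> last T = None)"
    using lst by (cases rule: edit.cases) (auto split: if_splits simp: last_append)
  with split[of T] fil show ?thesis by auto
qed

lemma (in A2_source) prefix_event_measurable:
  "{\<omega> \<in> space M. P (source_prefix X r \<omega>)} \<in> sets M"
proof -
  have "{\<omega> \<in> space M. source_prefix X r \<omega> = w} \<in> sets M" for w
  proof -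
    have "{\<omega> \<in> space M. source_prefix X r \<omega> = w} =
        {\<omega> \<in> space M. length w = r \<and> (\<forall>k\<in>{..<r}. X k \<omega> = w ! k)}"
      by (auto simp: source_prefix_def list_eq_iff_nth_eq)
    also have "\<dots> \<in> sets M"
    proof -
      have "{\<omega> \<in> space M. X k \<omega> = a} \<in> sets M" for k a
        using measurable_sets[OF measurable_X[of k], of "{a}"]
        by (simp add: vimage_def Int_def conj_commute)
      then show ?thesis by (intro sets.sets_Collect sets.sets_Collect_finite_All) auto
    qed
    finally show ?thesis .
  qed
  moreover have "{\<omega> \<in> space M. P (source_prefix X r \<omega>)} =
      (\<Union>w\<in>{w. set w \<subseteq> UNIV \<and> length w = r \<and> P w}. {\<omega> \<in> space M. source_prefix X r \<omega> = w})"
    by (auto simp: source_prefix_def)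
  moreover have "finite {w. set w \<subseteq> (UNIV::'a set) \<and> length w = r \<and> P w}"
    by (rule finite_subset[OF _ finite_lists_length_eq[of "UNIV::'a set" r]]) auto
  ultimately show ?thesis by (simp add: sets.finite_UN)
qed

end

theory Submission imports Defs begin

text \<open>
  Fix a length \<open>L\<close> such that no factor of length \<open>L\<close> occurs twice in the base string \<open>S\<close>. Cut every
  suffix of a document after \<open>L\<close> symbols. In the unedited collection every document has each of the
  \<open>|S| + 1\<close> cut suffixes exactly once, and an edit changes at most \<open>L + 1\<close> of them. An ILCP entry
  is the longest common prefix of a suffix with its predecessor in the same document; it is
  determined by the cut suffixes as long as the suffix has a unique cut, and inserting or removing
  one cut suffix affects the predecessor of at most one other. So all but \<open>O(s L)\<close> entries carry the
  value that their cut suffix has in \<open>S\<close>, and since the suffix array lists the cut suffixes in sorted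
  order, these entries form at most \<open>|S|\<close> runs.

  By strong mixing, two windows of length \<open>L\<close> of the source agree with probability exponentially
  small in \<open>L\<close>, so a union bound over pairs of positions allows \<open>L = O(lg r)\<close>.
\<close>

section \<open>Truncation, common prefixes and runs\<close>

text \<open>Turns a suffix of the text into the corresponding suffix of its document. The terminator
  is appended unconditionally, which also gives a value to strings without one.\<close>

definition cut :: "'a option list \<Rightarrow> 'a option list" where
  "cut xs = takeWhile (\<lambda>x. x \<noteq> None) xs @ [None]"

lemma cut_simps [simp]:
  "cut [] = [None]" "cut (None # xs) = [None]" "cut (Some a # xs) = Some a # cut xs"
  by (simp_all add: cut_def)

lemma cut_append_None: "cut (map Some w @ None # v) = map Some w @ [None]"
  by (induction w) auto

lemma None_le_cut: "[None] \<le> cut (y :: 'a::linorder option list)"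
  by (cases y rule: documents.cases) auto

text \<open>\<open>None\<close> is the least symbol: differences behind the first terminator
  disappear, earlier ones keep their direction.\<close>

lemma cut_mono: "x \<le> y \<Longrightarrow> cut x \<le> cut (y :: 'a::linorder option list)"
proof (induction x arbitrary: y)
  case Nil
  then show ?case by (simp add: None_le_cut)
next
  case (Cons a x)
  then obtain b y' where y: "y = b # y'" by (cases y) auto
  show ?case
    using Cons.prems Cons.IH[of y'] None_le_cut[of "Some _ # y'"]
    by (cases a; cases b) (auto simp: y)
qed

lemma cut_less: "cut x < cut y \<Longrightarrow> x < (y :: 'a::linorder option list)"
  using cut_mono[of y x] by (meson leD leI)

lemma take_mono: "x \<le> y \<Longrightarrow> take k x \<le> take k (y :: 'a::linorder list)"
proof (induction k arbitrary: x y)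
  case (Suc k)
  then show ?case by (cases x; cases y) auto
qed simp

lemma take_less: "take k x < take k y \<Longrightarrow> x < (y :: 'a::linorder list)"
  using take_mono[of y x k] by (meson leD leI)

section \<open>Common prefixes under the lexicographic order\<close>

abbreviation lcp :: "'b list \<Rightarrow> 'b list \<Rightarrow> nat" where
  "lcp x y \<equiv> length (longest_common_prefix x y)"

text \<open>Every string between \<open>x\<close> and \<open>z\<close> begins with their common
  prefix. Hence the nearest smaller string attains the largest common prefix with
  \<open>z\<close>.\<close>

lemma lcp_mono:
  "x \<le> y \<Longrightarrow> y \<le> z \<Longrightarrow> lcp x z \<le> lcp y (z :: 'a::linorder list)"
proof (induction x z arbitrary: y rule: longest_common_prefix.induct)
  case (1 a x b z)
  then show ?case by (cases y) auto
qed auto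

text \<open>Truncations differ only if the common prefix is shorter than \<open>k\<close>, and then
  truncating leaves it alone.\<close>

lemma lcp_take: "take k x \<noteq> take k y \<Longrightarrow> lcp (take k x) (take k y) = lcp x y"
proof (induction x y arbitrary: k rule: longest_common_prefix.induct)
  case (1 a x b y)
  then show ?case by (cases k) auto
qed (simp_all)

section \<open>Counting blocks of equal neighbours\<close>

lemma length_remdups_adj_Cons:
  "length (remdups_adj (x # xs)) =
     length (remdups_adj xs) + (if xs \<noteq> [] \<and> x = hd xs then 0 else 1)"
  by (cases xs) auto

text \<open>A rejected element costs at most two blocks: its own, and one more for splitting a block
  of kept elements. The summand for a rejected head strengthens the induction: it pays for the block
  that a kept element may open in front of a rejected one.\<close>

lemma length_remdups_adj_filter:
  "length (remdups_adj (map g ps)) + (if ps \<noteq> [] \<and> \<not> P (hd ps) then 1 else 0)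
    \<le> length (remdups_adj (map g (filter P ps))) + 2 * length (filter (\<lambda>p. \<not> P p) ps)"
proof (induction ps)
  case (Cons p ps)
  show ?case
  proof (cases "P p")
    case False
    then show ?thesis using Cons by (auto simp: length_remdups_adj_Cons)
  next
    case True
    show ?thesis
      using Cons True
      by (cases ps) (auto simp: length_remdups_adj_Cons simp del: remdups_adj.simps split: if_splits)
  qed
qed simp

lemma length_remdups_adj_map: "length (remdups_adj (map v xs)) \<le> length (remdups_adj xs)"
proof (induction xs)
  case (Cons x xs)
  then show ?case
    by (cases xs) (auto simp: length_remdups_adj_Cons simp del: remdups_adj.simps(3))
qed simp

lemma length_remdups_adj_sorted:
  "sorted xs \<Longrightarrow> length (remdups_adj xs) = card (set xs)"
proof (induction xs)
  case (Cons x xs)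
  show ?case
  proof (cases "xs \<noteq> [] \<and> x = hd xs")
    case True
    then have "set (x # xs) = set xs" by (cases xs) auto
    then show ?thesis using Cons True unfolding length_remdups_adj_Cons by simp
  next
    case False
    then have "x \<notin> set xs" using Cons.prems by (cases xs) auto
    then show ?thesis using Cons False unfolding length_remdups_adj_Cons by simp
  qed
qed simp

text \<open>Runs are counted by the block in which they start: two runs starting in the same block
  have a constant hull and coincide by maximality.\<close>

lemma num_runs_le: "num_runs xs \<le> length (remdups_adj xs)"
proof -
  obtain f where f: "mono f" "f ` {0..<length xs} = {0..<length (remdups_adj xs)}"
    "\<And>i. i < length xs \<Longrightarrow> xs ! i = remdups_adj xs ! f i"
    using remdups_adj_altdef[THEN iffD1, OF refl, of xs] by blast
  have inj: "i = i' \<and> j = j'"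
    if run: "is_run xs i j" and run': "is_run xs i' j'" and eq: "f (i - 1) = f (i' - 1)" for i j i' j'
  proof -
    define a where "a = min i i'" define b where "b = max j j'"
    have c: "\<And>k. k \<in> {i..j} \<Longrightarrow> xs !\<^sub>1 k = xs !\<^sub>1 i" "\<And>k. k \<in> {i'..j'} \<Longrightarrow> xs !\<^sub>1 k = xs !\<^sub>1 i'"
      "1 \<le> i" "i \<le> j" "j \<le> length xs" "1 \<le> i'" "i' \<le> j'" "j' \<le> length xs"
      using run run' unfolding is_run_def constant_between_def by blast+
    have ab: "1 \<le> a" "b \<le> length xs" "a \<le> b"
      using c(3-8) by (auto simp: a_def b_def)
    have nth_f: "xs !\<^sub>1 k = remdups_adj xs ! f (k - 1)" if "1 \<le> k" "k \<le> length xs" for k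
      using that by (intro f(3)) linarith
    have ii: "xs !\<^sub>1 i = xs !\<^sub>1 i'" using nth_f[of i] nth_f[of i'] c(3-8) eq le_trans by metis
    have "xs !\<^sub>1 k = xs !\<^sub>1 i" if k: "k \<in> {a..b}" for k
    proof -
      \<comment> \<open>A position of the hull lies in one of the runs or between their starts;
        there monotonicity of \<open>f\<close> squeezes it into the common block.\<close>
      consider "k \<in> {i..j}" | "k \<in> {i'..j'}" | "a \<le> k" "k \<le> max i i'"
      proof -
        have "k \<le> j \<or> k \<le> j'" "a \<le> k" using k by (simp_all add: b_def le_max_iff_disj)
        show ?thesis
        proof (cases "k \<le> max i i'")
          case True
          with \<open>a \<le> k\<close> show ?thesis by (rule that(3))
        next
          case False
          then have "i \<le> k" "i' \<le> k" by simp_all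
          with \<open>k \<le> j \<or> k \<le> j'\<close> show ?thesis using that(1,2) by (meson atLeastAtMost_iff)
        qed
      qed
      then show ?thesis
      proof cases
        case 3
        then have "f (a - 1) \<le> f (k - 1)" "f (k - 1) \<le> f (max i i' - 1)"
          by (auto intro!: monoD[OF f(1)] diff_le_mono)
        moreover have "f (a - 1) = f (i - 1)" "f (max i i' - 1) = f (i - 1)"
          using eq by (simp_all add: a_def max_def min_def)
        ultimately have "f (k - 1) = f (i - 1)" by linarith
        moreover have "1 \<le> k" "k \<le> length xs" using c(3-8) 3 ab by linarith+
        moreover have "i \<le> length xs" using c(3-8) by linarith
        ultimately show ?thesis using nth_f[of k] nth_f[of i] c(3) by metis
      next
        case 1 then show ?thesis by (rule c(1))
      next
        case 2 then show ?thesis using c(2) ii by metis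
      qed
    qed
    then have "\<forall>k\<in>{a..b}. xs !\<^sub>1 k = xs !\<^sub>1 a"
      using ab by (metis atLeastAtMost_iff order_refl)
    then have "constant_between xs a b"
      using ab unfolding constant_between_def by blast
    moreover have "a \<le> i" "a \<le> i'" "j \<le> b" "j' \<le> b" by (auto simp: a_def b_def)
    ultimately have "a = i \<and> b = j" "a = i' \<and> b = j'"
      using run[unfolded is_run_def] run'[unfolded is_run_def] by blast+
    then show ?thesis by blast
  qed
  have "inj_on (\<lambda>(i, j). f (i - 1)) {(i, j). is_run xs i j}"
  proof (rule inj_onI, clarify)
    fix i j i' j' assume "is_run xs i j" "is_run xs i' j'" "f (i - 1) = f (i' - 1)"
    then show "i = i' \<and> j = j'" by (rule inj)
  qed
  moreover have "(\<lambda>(i, j). f (i - 1)) ` {(i, j). is_run xs i j} \<subseteq> {0..<length (remdups_adj xs)}"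
    unfolding f(2)[symmetric] by (auto simp: is_run_def constant_between_def)
  ultimately have "card {(i, j). is_run xs i j} \<le> card {0..<length (remdups_adj xs)}"
    by (rule card_inj_on_le) simp
  then show ?thesis by (simp add: num_runs_def)
qed

section \<open>Longest common prefixes with smaller strings\<close>

text \<open>The first component is a document number, so only strings of the document of
  \<open>x\<close> compete. If these are all its suffixes, this is the LCP entry at
  \<open>x\<close>; the inserted 0 serves the smallest suffix.\<close>

definition max_lcp :: "(nat \<times> 'b::linorder list) set \<Rightarrow> nat \<times> 'b list \<Rightarrow> nat" where
  "max_lcp A x = Max (insert 0 ((\<lambda>y. lcp y (snd x)) ` {y. (fst x, y) \<in> A \<and> y < snd x}))"

lemma finite_section: "finite A \<Longrightarrow> finite {y. (j, y) \<in> A \<and> P y}"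
  by (rule finite_subset[of _ "snd ` A"]) force+

lemma le_max_lcp: "finite A \<Longrightarrow> (fst x, y) \<in> A \<Longrightarrow> y < snd x \<Longrightarrow> lcp y (snd x) \<le> max_lcp A x"
  unfolding max_lcp_def by (rule Max_ge) (auto intro: finite_section)

lemma max_lcp_cases:
  assumes "finite A"
  obtains "max_lcp A x = 0"
  | y where "(fst x, y) \<in> A" "y < snd x" "max_lcp A x = lcp y (snd x)"
proof -
  have "max_lcp A x \<in> insert 0 ((\<lambda>y. lcp y (snd x)) ` {y. (fst x, y) \<in> A \<and> y < snd x})"
    unfolding max_lcp_def by (rule Max_in) (use assms in \<open>auto intro: finite_section\<close>)
  with that show ?thesis by auto
qed

lemma max_lcp_mono: "finite B \<Longrightarrow> A \<subseteq> B \<Longrightarrow> max_lcp A x \<le> max_lcp B x"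
  unfolding max_lcp_def by (rule Max_mono) (auto intro: finite_section)

text \<open>The value changes at \<open>x\<close> only if some \<open>b\<close> of \<open>B\<close>
  lies below \<open>x\<close> with no element of \<open>A\<close> in between, as such an element
  would have at least as long a common prefix. This \<open>b\<close> determines \<open>x\<close> as
  the next element of \<open>A\<close> above it in its document.\<close>

lemma card_max_lcp_Un:
  assumes fin: "finite A" "finite B"
  shows "card {x \<in> A. max_lcp (A \<union> B) x \<noteq> max_lcp A x} \<le> card B"
proof -
  let ?C = "{x \<in> A. max_lcp (A \<union> B) x \<noteq> max_lcp A x}"
  define R where "R = (\<lambda>x b. b \<in> B \<and> fst b = fst x \<and> snd b < snd x \<and>
      (\<forall>a\<in>A. fst a = fst x \<and> snd b \<le> snd a \<longrightarrow> \<not> snd a < snd x))"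
  have "\<forall>x\<in>?C. \<exists>b. R x b"
  proof
    fix x assume "x \<in> ?C"
    then have less: "max_lcp A x < max_lcp (A \<union> B) x"
      using max_lcp_mono[of "A \<union> B" A x] fin by auto
    obtain b where b: "(fst x, b) \<in> A \<union> B" "b < snd x" "max_lcp (A \<union> B) x = lcp b (snd x)"
      by (rule max_lcp_cases[of "A \<union> B" x]) (use less fin in auto)
    have no: "\<not> a < snd x" if "(fst x, a) \<in> A" "b \<le> a" for a
    proof
      assume "a < snd x"
      then have "lcp a (snd x) \<le> max_lcp A x" "lcp b (snd x) \<le> lcp a (snd x)"
        using le_max_lcp[OF fin(1) that(1)] lcp_mono[OF that(2), of "snd x"] by auto
      then show False using less b(3) by linarith
    qed
    have "(fst x, b) \<in> B" using b(1,2) no by blast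
    then have "R x (fst x, b)" using b(2) no by (auto simp: R_def)
    then show "\<exists>b. R x b" ..
  qed
  from bchoice[OF this] obtain \<phi> where \<phi>: "\<forall>x\<in>?C. R x (\<phi> x)" ..
  have "inj_on \<phi> ?C"
  proof (rule inj_onI)
    fix x y assume xy: "x \<in> ?C" "y \<in> ?C" "\<phi> x = \<phi> y"
    have Rx: "R x (\<phi> x)" and Ry: "R y (\<phi> x)" using bspec[OF \<phi> xy(1)] bspec[OF \<phi> xy(2)] xy(3) by simp_all
    have fst: "fst x = fst y" using Rx Ry by (simp add: R_def)
    have "\<not> snd x < snd y" "\<not> snd y < snd x"
      using Rx Ry xy fst by (auto simp: R_def)
    then show "x = y" using fst by (simp add: prod_eq_iff)
  qed
  moreover have "\<phi> ` ?C \<subseteq> B" using \<phi> by (auto simp: R_def)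
  ultimately show ?thesis by (rule card_inj_on_le) (rule fin)
qed

text \<open>Both sets arise from their intersection by additions, so each is compared with the
  intersection separately.\<close>

lemma card_max_lcp_neq:
  assumes fin: "finite A" "finite B"
  shows "card {x \<in> A \<inter> B. max_lcp A x \<noteq> max_lcp B x} \<le> card (A - B) + card (B - A)"
proof -
  let ?I = "A \<inter> B"
  let ?D = "\<lambda>E. {x \<in> ?I. max_lcp (?I \<union> E) x \<noteq> max_lcp ?I x}"
  have eq: "?I \<union> (A - B) = A" "?I \<union> (B - A) = B" by auto
  have "{x \<in> ?I. max_lcp A x \<noteq> max_lcp B x} \<subseteq> ?D (A - B) \<union> ?D (B - A)"
    unfolding eq by auto
  then have "card {x \<in> ?I. max_lcp A x \<noteq> max_lcp B x} \<le> card (?D (A - B) \<union> ?D (B - A))"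
    using fin by (intro card_mono) auto
  also have "\<dots> \<le> card (?D (A - B)) + card (?D (B - A))" by (rule card_Un_le)
  also have "\<dots> \<le> card (A - B) + card (B - A)"
    using fin by (intro add_mono card_max_lcp_Un) auto
  finally show ?thesis .
qed

text \<open>If the truncation of \<open>x\<close> has multiplicity one, no smaller string of its
  document shares it. Truncation then preserves both the order relative to \<open>x\<close> and the
  common prefixes.\<close>

lemma max_lcp_truncate:
  fixes xs :: "(nat \<times> 'b::linorder list) list"
  assumes x: "x \<in> set xs"
    and single: "count (mset (map (apsnd (take L)) xs)) (apsnd (take L) x) = 1"
  shows "max_lcp (set xs) x = max_lcp (set (map (apsnd (take L)) xs)) (apsnd (take L) x)"
proof -
  obtain j z where jz: "x = (j, z)" by force
  have differ: "take L y \<noteq> take L z" if "(j, y) \<in> set xs" "y < z" for y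
  proof
    assume eq: "take L y = take L z"
    have "{#(j, y), x#} \<subseteq># mset xs"
      using that x jz by (auto simp: subseteq_mset_def)
    then have "image_mset (apsnd (take L)) {#(j, y), x#} \<subseteq># image_mset (apsnd (take L)) (mset xs)"
      by (rule image_mset_subseteq_mono)
    then have "{#apsnd (take L) x, apsnd (take L) x#} \<subseteq># mset (map (apsnd (take L)) xs)"
      using eq jz by simp
    from mset_subset_eq_count[OF this, of "apsnd (take L) x"] single show False by simp
  qed
  have "(\<lambda>y. lcp y z) ` {y. (j, y) \<in> set xs \<and> y < z} =
      (\<lambda>y. lcp y (take L z)) ` {y. (j, y) \<in> apsnd (take L) ` set xs \<and> y < take L z}"
    (is "?l = ?r")
  proof
    show "?l \<subseteq> ?r"
    proof clarify
      fix y assume y: "(j, y) \<in> set xs" "y < z"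
      then have "take L y < take L z" using differ take_mono[of y z L] by fastforce
      moreover have "(j, take L y) \<in> apsnd (take L) ` set xs" using y(1) by force
      ultimately show "lcp y z \<in> ?r"
        using lcp_take[OF differ[OF y]] by (intro image_eqI[of _ _ "take L y"]) auto
    qed
    show "?r \<subseteq> ?l"
    proof
      fix k assume "k \<in> ?r"
      then obtain y where y: "(j, y) \<in> set xs" "take L y < take L z" "k = lcp (take L y) (take L z)"
        by auto
      then show "k \<in> ?l"
        using lcp_take[of L y z] take_less[OF y(2)] by (intro image_eqI[of _ _ y]) auto
    qed
  qed
  then show ?thesis by (simp add: max_lcp_def jz)
qed

text \<open>Multiplicities u in \<open>mset_set U\<close> are at most 1, so k > u implies k <= 2 *
  (k - u).\<close>

lemma count_excess:
  "size (filter_mset (\<lambda>y. count M y > count (mset_set U) y) M) \<le> 2 * size (M - mset_set U)"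
proof -
  have "filter_mset (\<lambda>y. count M y > count (mset_set U) y) M \<subseteq># (M - mset_set U) + (M - mset_set U)"
    by (rule mset_subset_eqI) (auto simp: count_mset_set')
  from size_mset_mono[OF this] show ?thesis by simp
qed

lemma size_multiset_diff_triangle: "size (A - C :: 'b multiset) \<le> size (A - B) + size (B - C)"
proof -
  have "A - C \<subseteq># (A - B) + (B - C)" by (rule mset_subset_eqI) auto
  from size_mset_mono[OF this] show ?thesis by simp
qed

lemma length_filter_disj:
  "(\<And>x. x \<in> set xs \<Longrightarrow> P x \<Longrightarrow> Q x \<or> R x) \<Longrightarrow>
    length (filter P xs) \<le> length (filter Q xs) + length (filter R xs)"
proof (induction xs)
  case (Cons x xs)
  then have "length (filter P xs) \<le> length (filter Q xs) + length (filter R xs)" by simp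
  with Cons.prems[of x] show ?case by auto
qed simp

text \<open>The truncation of an irregular entry either occurs more often than in \<open>U\<close>,
  which costs twice the excess, or it occurs once, lies in \<open>U\<close>, and its value differs
  between the two sets. The latter entries are bounded by the symmetric difference, hence the
  factors 3 and 1.\<close>

lemma length_filter_irregular:
  fixes xs :: "(nat \<times> 'b::linorder list) list" and L :: nat
  defines "t \<equiv> apsnd (take L)"
  assumes finU: "finite U"
  shows "length (filter (\<lambda>x. \<not> (t x \<in> U \<and> max_lcp (set xs) x = max_lcp U (t x))) xs)
    \<le> 3 * size (mset (map t xs) - mset_set U) + size (mset_set U - mset (map t xs))"
proof -
  define M where "M = mset (map t xs)"
  define G where "G = set (map t xs)"
  have GM: "G = set_mset M" by (simp add: G_def M_def)
  define bad where "bad = (\<lambda>y. count M y > count (mset_set U) y)"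
  define Q where "Q = (\<lambda>y. count M y = 1 \<and> y \<in> U \<and> max_lcp G y \<noteq> max_lcp U y)"
  have "bad (t x) \<or> Q (t x)"
    if x: "x \<in> set xs" "\<not> (t x \<in> U \<and> max_lcp (set xs) x = max_lcp U (t x))" for x
  proof (rule ccontr)
    assume not: "\<not> (bad (t x) \<or> Q (t x))"
    have "count M (t x) \<ge> 1" using x(1) by (auto simp: M_def Suc_le_eq)
    moreover have "count M (t x) \<le> count (mset_set U) (t x)"
      using not by (simp add: bad_def)
    moreover have "count (mset_set U) (t x) = (if t x \<in> U then 1 else 0)"
      using finU by (simp add: count_mset_set')
    ultimately have "t x \<in> U" "count M (t x) = 1" by (metis le_antisym not_one_le_zero order_trans)+
    moreover from this(2) have "max_lcp (set xs) x = max_lcp G (t x)"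
      using max_lcp_truncate[OF x(1), of L] by (simp add: M_def G_def t_def)
    ultimately show False using not x(2) by (auto simp: Q_def)
  qed
  then have "length (filter (\<lambda>x. \<not> (t x \<in> U \<and> max_lcp (set xs) x = max_lcp U (t x))) xs)
      \<le> length (filter (\<lambda>x. bad (t x)) xs) + length (filter (\<lambda>x. Q (t x)) xs)"
    by (rule length_filter_disj)
  also have "\<dots> = size (filter_mset bad M) + size (filter_mset Q M)"
    by (simp add: M_def filter_mset_image_mset flip: mset_filter)
  also have "size (filter_mset bad M) \<le> 2 * size (M - mset_set U)"
    unfolding bad_def by (rule count_excess)
  also have "size (filter_mset Q M) \<le> card (G - U) + card (U - G)"
  proof -
    have "filter_mset Q M = mset_set {y \<in> G. Q y}"
      by (rule multiset_eqI) (auto simp: Q_def GM count_mset_set' intro: count_inI)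
    then have "size (filter_mset Q M) = card {y \<in> G. Q y}" by simp
    also have "\<dots> \<le> card {y \<in> G \<inter> U. max_lcp G y \<noteq> max_lcp U y}"
      using finU by (intro card_mono) (auto simp: Q_def)
    also have "\<dots> \<le> card (G - U) + card (U - G)"
      using finU by (intro card_max_lcp_neq) (auto simp: G_def)
    finally show ?thesis .
  qed
  also have "card (G - U) \<le> size (M - mset_set U)"
  proof -
    have "mset_set (G - U) \<subseteq># M - mset_set U"
      by (rule mset_subset_eqI) (auto simp: count_mset_set' GM Suc_le_eq)
    from size_mset_mono[OF this] show ?thesis by simp
  qed
  also have "card (U - G) \<le> size (mset_set U - M)"
  proof -
    have "mset_set (U - G) \<subseteq># mset_set U - M"
      by (rule mset_subset_eqI) (use finU in \<open>auto simp: count_mset_set' GM not_in_iff\<close>)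
    from size_mset_mono[OF this] show ?thesis by simp
  qed
  finally show ?thesis by (simp add: M_def)
qed

section \<open>Cut suffixes and edits\<close>

definition suffs :: "'b list \<Rightarrow> 'b list list" where
  "suffs D = map (\<lambda>i. drop i D) [0..<length D]"

lemma suffs_simps [simp]: "suffs [] = []" "suffs (x # D) = (x # D) # suffs D"
  by (simp_all add: suffs_def map_upt_Suc del: upt_Suc)

lemma distinct_suffs: "distinct (suffs D)"
  by (auto simp: suffs_def distinct_map inj_on_def dest!: arg_cong[where f = length])

text \<open>Document number and suffix within the document of a text position, both counted from 0,
  in contrast to the 1-based arrays.\<close>

definition site :: "'a option list \<Rightarrow> nat \<Rightarrow> nat \<times> 'a option list" where
  "site T i = (count_list (take i T) None, cut (drop i T))"

definition sites :: "'a option list \<Rightarrow> (nat \<times> 'a option list) list" where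
  "sites T = map (site T) [0..<length T]"

abbreviation tag :: "nat \<Rightarrow> nat \<times> 'b list \<Rightarrow> nat \<times> 'b list" where
  "tag L \<equiv> apsnd (take L)"

abbreviation tags :: "nat \<Rightarrow> 'a option list \<Rightarrow> (nat \<times> 'a option list) list" where
  "tags L T \<equiv> map (tag L) (sites T)"

lemma length_sites [simp]: "length (sites T) = length T"
  by (simp add: sites_def)

lemma nth_sites [simp]: "i < length T \<Longrightarrow> sites T ! i = site T i"
  by (simp add: sites_def)

lemma sites_simps [simp]:
  "sites [] = []"
  "sites (None # T) = (0, [None]) # map (apfst Suc) (sites T)"
  "sites (Some a # T) = (0, Some a # cut T) # sites T"
  by (simp_all add: sites_def site_def map_upt_Suc o_def del: upt_Suc)

section \<open>Tags under concatenation and edits\<close>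

lemma sites_append_terminated:
  "sites (map Some w @ None # T) =
     map (Pair 0) (suffs (map Some w @ [None])) @ map (apfst Suc) (sites T)"
  by (induction w) (auto simp: cut_append_None)

text \<open>Positions of \<open>v\<close> depend on \<open>u\<close> only through its number of
  terminators, whereas a suffix starting in \<open>u\<close> may read on into
  \<open>v\<close>.\<close>

lemma tags_append:
  "tags L (u @ v) =
     map (\<lambda>i. (count_list (take i u) None, take L (cut (drop i u @ v)))) [0..<length u]
       @ map (apfst ((+) (count_list u None))) (tags L v)"
proof (induction u)
  case (Cons x u)
  show ?case
  proof (cases x)
    case None
    have "tags L ((x # u) @ v) = (0, take L [None]) # map (apfst Suc) (tags L (u @ v))"
      by (simp add: None o_def)
    then show ?thesis
      unfolding Cons.IH by (simp add: None map_upt_Suc o_def del: upt_Suc)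
  next
    case (Some a)
    then show ?thesis using Cons.IH by (simp add: map_upt_Suc o_def del: upt_Suc)
  qed
qed (simp add: apfst_def map_prod_def o_def)

lemma take_cut_append: "L \<le> length xs \<Longrightarrow> take L (cut (xs @ v)) = take L (cut xs)"
proof (induction xs arbitrary: L)
  case (Cons x xs)
  then show ?case by (cases x; cases L) auto
qed simp

text \<open>A truncated suffix starting before position \<open>length u - L\<close> ends before it
  reaches \<open>z\<close>, and without terminators \<open>z\<close> does not shift the document
  numbers of \<open>v\<close>. So only \<open>mid\<close> depends on \<open>z\<close>.\<close>

lemma tags_local:
  assumes "None \<notin> set z"
  shows "\<exists>mid. length mid \<le> L + length z \<and> tags L (u @ z @ v) =
    map (\<lambda>i. (count_list (take i u) None, take L (cut (drop i u)))) [0..<length u - L] @ mid @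
    map (apfst ((+) (count_list u None))) (tags L v)"
proof -
  let ?h = "\<lambda>i. (count_list (take i (u @ z)) None, take L (cut (drop i (u @ z) @ v)))"
  have upt: "[0..<length (u @ z)] = [0..<length u - L] @ [length u - L..<length (u @ z)]"
    using upt_add_eq_append[of 0 "length u - L" "length (u @ z) - (length u - L)"] by simp
  have "map ?h [0..<length u - L] =
      map (\<lambda>i. (count_list (take i u) None, take L (cut (drop i u)))) [0..<length u - L]"
    by (auto intro: take_cut_append)
  moreover have "tags L (u @ z @ v) = map ?h [0..<length (u @ z)] @
      map (apfst ((+) (count_list u None))) (tags L v)"
    using tags_append[of L "u @ z" v] assms by simp
  ultimately have "tags L (u @ z @ v) =
    map (\<lambda>i. (count_list (take i u) None, take L (cut (drop i u)))) [0..<length u - L] @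
    map ?h [length u - L..<length (u @ z)] @
    map (apfst ((+) (count_list u None))) (tags L v)"
    unfolding upt by simp
  then show ?thesis by (intro exI[of _ "map ?h [length u - L..<length (u @ z)]"]) simp
qed

text \<open>All three kinds of edits replace a block of at most one symbol, not a terminator, by
  another such block. By \<open>tags_local\<close> the outer parts agree and the middle parts have
  length at most \<open>L + 1\<close>.\<close>

lemma edit_tags:
  assumes "edit T T'"
  shows "size (mset (tags L T) - mset (tags L T')) \<le> L + 1"
    "size (mset (tags L T') - mset (tags L T)) \<le> L + 1"
proof -
  have "\<exists>u z z' v. T = u @ z @ v \<and> T' = u @ z' @ v \<and> None \<notin> set z \<and> None \<notin> set z' \<and>
      length z \<le> 1 \<and> length z' \<le> 1"
    using assms
  proof cases
    case (insertion v u b)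
    then show ?thesis by (intro exI[of _ u] exI[of _ "[]"] exI[of _ "[Some b]"] exI[of _ v]) simp
  next
    case (deletion u a v)
    then show ?thesis by (intro exI[of _ u] exI[of _ "[Some a]"] exI[of _ "[]"] exI[of _ v]) simp
  next
    case (substitution u a v b)
    then show ?thesis
      by (intro exI[of _ u] exI[of _ "[Some a]"] exI[of _ "[Some b]"] exI[of _ v]) simp
  qed
  then obtain u z z' v where T: "T = u @ z @ v" "T' = u @ z' @ v"
    and z: "None \<notin> set z" "None \<notin> set z'" "length z \<le> 1" "length z' \<le> 1"
    by blast
  from tags_local[OF z(1), of L u v] tags_local[OF z(2), of L u v]
  obtain pre mid mid' post where m: "tags L T = pre @ mid @ post" "tags L T' = pre @ mid' @ post"
    "length mid \<le> L + length z" "length mid' \<le> L + length z'"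
    unfolding T by blast
  have "size (mset (xs @ ys @ zs) - mset (xs @ ys' @ zs)) \<le> length ys" for xs ys ys' zs :: "'b list"
  proof -
    have "mset (xs @ ys @ zs) - mset (xs @ ys' @ zs) \<subseteq># mset ys" by (rule mset_subset_eqI) auto
    from size_mset_mono[OF this] show ?thesis by simp
  qed
  then show "size (mset (tags L T) - mset (tags L T')) \<le> L + 1"
    "size (mset (tags L T') - mset (tags L T)) \<le> L + 1"
    unfolding m(1,2) using m(3,4) z(3,4) by (meson add_left_mono order_trans)+
qed

lemma edits_tags:
  assumes "(edit ^^ s) T T'"
  shows "size (mset (tags L T) - mset (tags L T')) \<le> s * (L + 1) \<and>
    size (mset (tags L T') - mset (tags L T)) \<le> s * (L + 1)"
  using assms
proof (induction s arbitrary: T')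
  case (Suc s)
  then obtain R where R: "(edit ^^ s) T R" "edit R T'" by auto
  show ?case
    using Suc.IH[OF R(1)] edit_tags[OF R(2), of L]
      size_multiset_diff_triangle[of "mset (tags L T)" "mset (tags L T')" "mset (tags L R)"]
      size_multiset_diff_triangle[of "mset (tags L T')" "mset (tags L T)" "mset (tags L R)"]
    by auto
qed simp

lemma edits_terminated:
  assumes "(edit ^^ s) (copies d S) T"
  shows "\<exists>ws. T = concat (map (\<lambda>w. map Some w @ [None]) ws)"
  using assms
proof (induction s arbitrary: T)
  case 0
  then show ?case
    by (intro exI[of _ "replicate d S"]) (simp add: copies_def)
next
  case (Suc s)
  then show ?case using edit_terminated by (metis relpowp_Suc_E)
qed

text \<open>Suffixes shorter than \<open>L\<close> are included whole, with their terminator; if all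
  truncations are distinct, there are \<open>length S + 1\<close> factors.\<close>

definition factors :: "nat \<Rightarrow> 'a list \<Rightarrow> 'a option list set" where
  "factors L S = take L ` set (suffs (map Some S @ [None]))"

lemma finite_factors [simp]: "finite (factors L S)"
  by (simp add: factors_def)

text \<open>Document numbers keep the copies apart, so every tag has multiplicity one. The induction
  peels off the first document and shifts the numbers of the others.\<close>

lemma mset_tags_copies:
  assumes distinct: "distinct (map (take L) (suffs (map Some S @ [None])))"
  shows "mset (tags L (copies d S)) = mset_set ({..<d} \<times> factors L S)"
proof -
  let ?F = "map (take L) (suffs (map Some S @ [None]))"
  have "distinct (tags L (copies d S)) \<and> set (tags L (copies d S)) = {..<d} \<times> factors L S"
  proof (induction d)
    case (Suc d)
    have eq: "tags L (copies (Suc d) S) = map (Pair 0) ?F @ map (apfst Suc) (tags L (copies d S))"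
      by (simp add: copies_def sites_append_terminated o_def)
    have "{..<Suc d} \<times> factors L S = Pair 0 ` factors L S \<union> apfst Suc ` ({..<d} \<times> factors L S)"
      by (auto simp: image_iff less_Suc_eq_0_disj)
    moreover have "inj_on (apfst Suc) A" for A :: "(nat \<times> 'a option list) set"
      by (auto simp: inj_on_def)
    ultimately show ?case
      unfolding eq using Suc distinct
      by (simp only: distinct_append distinct_map set_append set_map factors_def)
        (auto simp: inj_on_def)
  qed (simp add: copies_def)
  then show ?thesis by (metis mset_set_set)
qed

lemma distinct_take_suffs:
  assumes "\<And>i j. i < j \<Longrightarrow> j + L \<le> length S \<Longrightarrow> take L (drop i S) \<noteq> take L (drop j S)"
  shows "distinct (map (take L) (suffs (map Some S @ [None])))"
proof -
  let ?D = "map Some S @ [None]"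
  have "take L (drop i ?D) \<noteq> take L (drop j ?D)" if "i < j" "j \<le> length S" for i j
  proof (cases "j + L \<le> length S")
    case True
    then show ?thesis
      using assms[OF that(1)] that by (simp add: drop_map take_map inj_map_eq_map)
  next
    case False
    have nth: "take L (drop l xs) ! k = xs ! (l + k)" if "k < L" "l + k < length xs"
      for l k and xs :: "'a option list"
      using that by simp
    \<comment> \<open>The later window reaches the terminator at offset \<open>length S - j\<close>,
      where the earlier one still shows a symbol of \<open>S\<close>.\<close>
    have "take L (drop i ?D) ! (length S - j) = Some (S ! (i + (length S - j)))"
      using False that by (subst nth) (auto simp: nth_append)
    moreover have "take L (drop j ?D) ! (length S - j) = None"
      using False that by (subst nth) (auto simp: nth_append)
    ultimately show ?thesis by force
  qed
  then have "inj_on (\<lambda>i. take L (drop i ?D)) {0..<Suc (length S)}"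
    by (intro linorder_inj_onI) auto
  then show ?thesis by (simp add: suffs_def distinct_map o_def del: upt_Suc)
qed

section \<open>The interleaved LCP array in terms of suffixes\<close>

abbreviation terminated :: "'a list \<Rightarrow> 'a option list" where
  "terminated w \<equiv> map Some w @ [None]"

text \<open>The hypotheses say that each document has its only terminator at its end, so the
  terminators before \<open>p\<close> count the documents completed before it. The equivalence in
  \<open>j\<close> is what the definite description in \<open>document_of\<close> asks for.\<close>

lemma document_position_iff:
  assumes "\<And>D. D \<in> set Ds \<Longrightarrow> count_list D None = 1"
    and "\<And>D m. D \<in> set Ds \<Longrightarrow> m < length D \<Longrightarrow> count_list (take m D) None = 0"
    and "1 \<le> p" "p \<le> length (concat Ds)"
  shows "1 \<le> j \<and> j \<le> length Ds \<and> length (concat (take (j - 1) Ds)) < p \<and>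
      p \<le> length (concat (take j Ds)) \<longleftrightarrow> j = count_list (take (p - 1) (concat Ds)) None + 1"
  using assms
proof (induction Ds arbitrary: p j)
  case (Cons D Ds)
  show ?case
  proof (cases "p \<le> length D")
    case True
    then have "count_list (take (p - 1) (concat (D # Ds))) None = 0"
      using Cons.prems(2)[of D "p - 1"] Cons.prems(3) by simp
    moreover have "1 \<le> j \<and> j \<le> length (D # Ds) \<and>
        length (concat (take (j - 1) (D # Ds))) < p \<and>
        p \<le> length (concat (take j (D # Ds))) \<longleftrightarrow> j = 1"
    proof (cases j)
      case (Suc i)
      then show ?thesis using True Cons.prems(3) by (cases i) auto
    qed simp
    ultimately show ?thesis by simp
  next
    case False
    \<comment> \<open>Beyond the first document the claim for \<open>p\<close> and \<open>j\<close>
      is the one for \<open>p - length D\<close> and \<open>j - 1\<close>.\<close>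
    let ?p = "p - length D"
    have "count_list (take (p - 1) (concat (D # Ds))) None =
        Suc (count_list (take (?p - 1) (concat Ds)) None)"
      using False Cons.prems(1)[of D] by simp
    moreover have "1 \<le> j \<and> j \<le> length (D # Ds) \<and>
        length (concat (take (j - 1) (D # Ds))) < p \<and>
        p \<le> length (concat (take j (D # Ds))) \<longleftrightarrow>
        1 \<le> j - 1 \<and> j - 1 \<le> length Ds \<and>
        length (concat (take (j - 1 - 1) Ds)) < ?p \<and> ?p \<le> length (concat (take (j - 1) Ds))"
    proof (cases j)
      case (Suc i)
      then show ?thesis using False by (cases i) auto
    qed simp
    moreover have "1 \<le> j - 1 \<and> j - 1 \<le> length Ds \<and>
        length (concat (take (j - 1 - 1) Ds)) < ?p \<and> ?p \<le> length (concat (take (j - 1) Ds)) \<longleftrightarrow>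
        j - 1 = count_list (take (?p - 1) (concat Ds)) None + 1"
    proof (rule Cons.IH)
      show "1 \<le> ?p" "?p \<le> length (concat Ds)"
        using False Cons.prems(3,4) by simp_all
    next
      fix E m assume "E \<in> set Ds"
      then have "E \<in> set (D # Ds)" by simp
      from Cons.prems(1)[OF this] show "count_list E None = 1" .
      assume "m < length E"
      from Cons.prems(2)[OF \<open>E \<in> set (D # Ds)\<close> this] show "count_list (take m E) None = 0" .
    qed
    ultimately show ?thesis by (simp only:) auto
  qed
qed simp

lemma document_of_eq:
  fixes ws :: "'a list list"
  defines "T \<equiv> concat (map terminated ws)"
  assumes "1 \<le> p" "p \<le> length T"
  shows "document_of T p = fst (site T (p - 1)) + 1"
proof -
  let ?Ds = "map terminated ws"
  have "1 \<le> j \<and> j \<le> length ?Ds \<and> length (concat (take (j - 1) ?Ds)) < p \<and>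
      p \<le> length (concat (take j ?Ds)) \<longleftrightarrow> j = count_list (take (p - 1) (concat ?Ds)) None + 1" for j
    using assms(2,3) unfolding T_def
    by (intro document_position_iff) (auto simp: count_list_0_iff take_map)
  then show ?thesis
    unfolding T_def document_of_def documents_concat_terminated site_def fst_conv by simp
qed

lemma sites_section:
  "{y. (k, y) \<in> set (sites (concat (map terminated ws)))} =
     (if k < length ws then set (suffs (terminated (ws ! k))) else {})"
proof (induction ws arbitrary: k)
  case (Cons w ws)
  have eq: "sites (concat (map terminated (w # ws))) =
      map (Pair 0) (suffs (terminated w)) @ map (apfst Suc) (sites (concat (map terminated ws)))"
    by (simp add: sites_append_terminated)
  show ?case
  proof (cases k)
    case (Suc i)
    then have "{y. (k, y) \<in> set (sites (concat (map terminated (w # ws))))} =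
        {y. (i, y) \<in> set (sites (concat (map terminated ws)))}"
      unfolding eq by force
    then show ?thesis using Cons.IH[of i] Suc by simp
  next
    case 0
    then show ?thesis unfolding eq by auto
  qed
qed simp

lemma distinct_sites: "distinct (sites (concat (map terminated ws)))"
proof (induction ws)
  case (Cons w ws)
  have eq: "sites (concat (map terminated (w # ws))) =
      map (Pair 0) (suffs (terminated w)) @ map (apfst Suc) (sites (concat (map terminated ws)))"
    by (simp add: sites_append_terminated)
  show ?case
    unfolding eq using Cons distinct_suffs[of "terminated w"]
    by (simp only: distinct_append distinct_map) (auto simp: inj_on_def)
qed simp

section \<open>Suffix array order, LCP entries and ranks\<close>

lemma sorted_suffix_array:
  "sorted_wrt (\<lambda>p q. suffix_from p X < suffix_from q X) (suffix_array X)"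
proof -
  note sa = is_suffix_array_suffix_array[of X, unfolded is_suffix_array_def]
  have len: "length (suffix_array X) = length X"
    using sa distinct_card[of "suffix_array X"] by simp
  have tr: "transp (\<lambda>p q. suffix_from p X < suffix_from q X)" by (rule transpI) simp
  show ?thesis
  proof (rule sorted_wrt_iff_nth_Suc_transp[OF tr, THEN iffD2], intro allI impI, goal_cases)
    case (1 i)
    then show ?case using sa len by (auto dest!: spec[of _ "Suc i"])
  qed
qed

lemma suffix_array_simps [simp]:
  "distinct (suffix_array X)" "set (suffix_array X) = {1..length X}"
  "length (suffix_array X) = length X"
  using is_suffix_array_suffix_array[of X] distinct_card[of "suffix_array X"]
  by (auto simp: is_suffix_array_def)

lemma set_take_sorted_wrt:
  fixes f :: "'b \<Rightarrow> 'c::linorder"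
  assumes "sorted_wrt (\<lambda>x y. f x < f y) xs" "i < length xs"
  shows "set (take (Suc i) xs) = {x \<in> set xs. f x \<le> f (xs ! i)}"
    "set (take i xs) = {x \<in> set xs. f x < f (xs ! i)}"
proof -
  have less: "f (xs ! a) < f (xs ! b)" if "a < b" "b < length xs" for a b
    using assms(1) that by (simp add: sorted_wrt_iff_nth_less)
  have le: "f (xs ! a) \<le> f (xs ! i) \<longleftrightarrow> a \<le> i" "f (xs ! a) < f (xs ! i) \<longleftrightarrow> a < i"
    if "a < length xs" for a
    using less[of a i] less[of i a] assms(2) that by (cases a i rule: linorder_cases; force)+
  have ind: "{a. a < length xs \<and> f (xs ! a) \<le> f (xs ! i)} = {0..<Suc i}"
    "{a. a < length xs \<and> f (xs ! a) < f (xs ! i)} = {0..<i}"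
    using le assms(2) by auto
  have sec: "{x \<in> set xs. P x} = (!) xs ` {a. a < length xs \<and> P (xs ! a)}" for P
    by (auto simp: set_conv_nth)
  show "set (take (Suc i) xs) = {x \<in> set xs. f x \<le> f (xs ! i)}"
    "set (take i xs) = {x \<in> set xs. f x < f (xs ! i)}"
    using assms(2) by (simp_all add: sec ind flip: nth_image)
qed

text \<open>The number of suffixes up to \<open>x\<close> is the index of \<open>x\<close> in the
  suffix array, and its predecessor there attains the maximum by \<open>lcp_mono\<close>.\<close>

lemma lcp_array_rank:
  fixes D :: "'b::linorder list"
  assumes "x \<in> set (suffs D)"
  shows "lcp_array D !\<^sub>1 card {y \<in> set (suffs D). y \<le> x} =
    Max (insert 0 ((\<lambda>y. lcp y x) ` {y \<in> set (suffs D). y < x}))"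
proof -
  define xs where "xs = map (\<lambda>p. suffix_from p D) (suffix_array D)"
  have sorted: "sorted_wrt (\<lambda>x y. x < y) xs"
    using sorted_suffix_array[of D] by (simp add: xs_def sorted_wrt_map)
  have set: "set xs = set (suffs D)"
  proof -
    have "{1..length D} = Suc ` {0..<length D}" by (auto simp: image_Suc_atLeastLessThan)
    then show ?thesis
      unfolding xs_def suffs_def set_map suffix_array_simps by (simp only: image_image) simp
  qed
  have len: "length xs = length D" by (simp add: xs_def)
  have dist: "distinct xs" using sorted strict_sorted_iff by blast
  obtain m where m: "m < length xs" "xs ! m = x"
    using assms unfolding set[symmetric] in_set_conv_nth by blast
  have le: "{y \<in> set xs. y \<le> x} = set (take (Suc m) xs)"
    and less: "{y \<in> set xs. y < x} = set (take m xs)"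
    using set_take_sorted_wrt[of "\<lambda>x. x", OF sorted m(1)] m(2) by simp_all
  have card: "card {y \<in> set xs. y \<le> x} = Suc m"
    unfolding le using dist m(1) by (subst distinct_card) auto
  \<comment> \<open>\<open>m\<close> counts from 0 and the array from 1; the entry 0 at the first
    place agrees with the inserted 0 of the maximum.\<close>
  have "lcp_array D !\<^sub>1 Suc m = (if m = 0 then 0 else lcp (xs ! (m - 1)) (xs ! m))"
    using m(1) len by (auto simp: lcp_array_def xs_def nth_append simp del: upt_Suc)
  also have "\<dots> = Max (insert 0 ((\<lambda>y. lcp y x) ` {y \<in> set xs. y < x}))"
  proof (cases m)
    case (Suc i)
    have "Max (insert 0 ((\<lambda>y. lcp y x) ` {y \<in> set xs. y < x})) = lcp (xs ! i) x"
    proof (rule Max_eqI)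
      have mem: "xs ! i \<in> {y \<in> set xs. y < x}"
        using m Suc nth_mem[of i xs] sorted_wrt_nth_less[OF sorted, of i m] by simp
      then show "lcp (xs ! i) x \<in> insert 0 ((\<lambda>y. lcp y x) ` {y \<in> set xs. y < x})" by blast
      fix k assume "k \<in> insert 0 ((\<lambda>y. lcp y x) ` {y \<in> set xs. y < x})"
      then consider "k = 0" | y where "y \<in> set xs" "y < x" "k = lcp y x" by blast
      then show "k \<le> lcp (xs ! i) x"
      proof cases
        case 2
        have "y \<in> set (take (Suc i) xs)" using 2 less Suc by blast
        then have "y \<le> xs ! i"
          using set_take_sorted_wrt(1)[of "\<lambda>x. x", OF sorted, of i] m(1) Suc by simp
        then show ?thesis using lcp_mono[of y "xs ! i" x] mem 2(3) by (simp add: less_imp_le)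
      qed simp
    qed simp
    then show ?thesis using m(2) Suc by simp
  qed (simp add: less)
  finally show ?thesis unfolding card[symmetric] set .
qed

text \<open>Forwards this is monotonicity of \<open>cut\<close>. Backwards it needs that the cut
  suffixes of one document are distinct, which makes the inequality strict for different
  positions.\<close>

lemma site_order:
  fixes ws :: "'a::linorder list list"
  defines "T \<equiv> concat (map terminated ws)"
  assumes "i < length T" "i' < length T" "fst (site T i) = fst (site T i')"
  shows "drop i T \<le> drop i' T \<longleftrightarrow> snd (site T i) \<le> snd (site T i')"
proof
  assume "drop i T \<le> drop i' T"
  then show "snd (site T i) \<le> snd (site T i')" by (simp add: site_def cut_mono)
next
  assume le: "snd (site T i) \<le> snd (site T i')"
  show "drop i T \<le> drop i' T"
  proof (cases "i = i'")
    case False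
    then have "site T i \<noteq> site T i'"
      using distinct_sites[of ws] assms(2,3) nth_eq_iff_index_eq[of "sites T" i i']
      by (simp add: T_def)
    then have "snd (site T i) < snd (site T i')"
      using le assms(4) by (simp add: prod_eq_iff)
    then show ?thesis using cut_less by (fastforce simp: site_def)
  qed simp
qed

text \<open>Up to index \<open>i\<close> the suffix array lists the suffixes not above the current
  one; those in its document correspond bijectively to the cut suffixes up to
  \<open>snd x\<close>.\<close>

lemma rank_document_array:
  fixes ws :: "'a::linorder list list"
  defines "T \<equiv> concat (map terminated ws)"
  assumes i: "1 \<le> i" "i \<le> length T"
  defines "x \<equiv> site T (suffix_array T !\<^sub>1 i - 1)"
  shows "rank (fst x + 1) (document_array T) i =
    card {y. (fst x, y) \<in> set (sites T) \<and> y \<le> snd x}"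
proof -
  let ?sa = "suffix_array T"
  define p where "p = ?sa !\<^sub>1 i"
  have p: "1 \<le> p" "p \<le> length T"
    using nth_mem[of "i - 1" ?sa] i by (auto simp: p_def)
  have x: "x = site T (p - 1)" by (simp add: x_def p_def)
  have take: "set (take i ?sa) = {q \<in> {1..length T}. suffix_from q T \<le> suffix_from p T}"
    using set_take_sorted_wrt(1)[OF sorted_suffix_array[of T], of "i - 1"] i by (simp add: p_def)
  let ?Q = "{q \<in> {1..length T}. suffix_from q T \<le> suffix_from p T \<and> fst (site T (q - 1)) = fst x}"
  have "rank (fst x + 1) (document_array T) i =
      length (filter (\<lambda>q. document_of T q = fst x + 1) (take i ?sa))"
    by (simp add: rank_def document_array_def take_map count_list_eq_length_filter filter_map o_def eq_commute)
  also have "\<dots> = card (set (filter (\<lambda>q. document_of T q = fst x + 1) (take i ?sa)))"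
    by (rule distinct_card[symmetric]) simp
  also have "set (filter (\<lambda>q. document_of T q = fst x + 1) (take i ?sa)) = ?Q"
    using document_of_eq[of _ ws] unfolding set_filter take by (auto simp: T_def)
  also have "card ?Q = card {y. (fst x, y) \<in> set (sites T) \<and> y \<le> snd x}"
  proof (rule bij_betw_same_card[of "\<lambda>q. snd (site T (q - 1))"], rule bij_betw_imageI)
    have order: "suffix_from q T \<le> suffix_from q' T \<longleftrightarrow> snd (site T (q - 1)) \<le> snd (site T (q' - 1))"
      if "q \<in> {1..length T}" "q' \<in> {1..length T}" "fst (site T (q - 1)) = fst (site T (q' - 1))" for q q'
      using that unfolding T_def by (intro site_order) auto
    show "inj_on (\<lambda>q. snd (site T (q - 1))) ?Q"
    proof (rule inj_onI)
      fix q q' assume q: "q \<in> ?Q" "q' \<in> ?Q" "snd (site T (q - 1)) = snd (site T (q' - 1))"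
      then have "sites T ! (q - 1) = sites T ! (q' - 1)" by (auto simp: prod_eq_iff)
      moreover have "distinct (sites T)" unfolding T_def by (rule distinct_sites)
      ultimately have "q - 1 = q' - 1"
        using q by (subst (asm) nth_eq_iff_index_eq) auto
      then show "q = q'" using q by auto
    qed
    show "(\<lambda>q. snd (site T (q - 1))) ` ?Q = {y. (fst x, y) \<in> set (sites T) \<and> y \<le> snd x}"
    proof
      show "(\<lambda>q. snd (site T (q - 1))) ` ?Q \<subseteq> {y. (fst x, y) \<in> set (sites T) \<and> y \<le> snd x}"
      proof clarify
        fix q assume q: "q \<in> {1..length T}" "suffix_from q T \<le> suffix_from p T"
          "fst (site T (q - 1)) = fst x"
        then have "snd (site T (q - 1)) \<le> snd x" using order[of q p] p x by simp
        moreover have "site T (q - 1) \<in> set (sites T)"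
          using q(1) by (auto simp: sites_def)
        ultimately show "(fst x, snd (site T (q - 1))) \<in> set (sites T) \<and> snd (site T (q - 1)) \<le> snd x"
          using q(3) by (simp add: prod.collapse flip: q(3))
      qed
      show "{y. (fst x, y) \<in> set (sites T) \<and> y \<le> snd x} \<subseteq> (\<lambda>q. snd (site T (q - 1))) ` ?Q"
      proof clarify
        fix y assume y: "(fst x, y) \<in> set (sites T)" "y \<le> snd x"
        then obtain k where k: "k < length T" "site T k = (fst x, y)"
          by (auto simp: sites_def)
        then have "Suc k \<in> ?Q" using order[of "Suc k" p] p x y(2) by simp
        then show "y \<in> (\<lambda>q. snd (site T (q - 1))) ` ?Q"
          using k(2) by (intro image_eqI[of _ _ "Suc k"]) auto
      qed
    qed
  qed
  finally show ?thesis .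
qed

text \<open>The rank in the document array is the place of the suffix in the suffix array of its own
  document, so \<open>lcp_array_rank\<close> applies. The interleaving survives only in the order of
  the entries.\<close>

lemma ilcp_eq:
  fixes ws :: "'a::linorder list list"
  defines "T \<equiv> concat (map terminated ws)"
  shows "ilcp T = map (\<lambda>p. max_lcp (set (sites T)) (site T (p - 1))) (suffix_array T)"
proof (rule nth_equalityI)
  fix k assume "k < length (ilcp T)"
  then have k: "k < length T" by (simp add: ilcp_def del: upt_Suc)
  let ?p = "suffix_array T ! k"
  let ?x = "site T (?p - 1)"
  have p: "1 \<le> ?p" "?p \<le> length T" using nth_mem[of k "suffix_array T"] k by auto
  have mem: "?x \<in> set (sites T)" using p by (auto simp: sites_def)
  then have "snd ?x \<in> {y. (fst ?x, y) \<in> set (sites T)}" by simp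
  then have lt: "fst ?x < length ws" and sec: "{y. (fst ?x, y) \<in> set (sites T)} = set (suffs (terminated (ws ! fst ?x)))"
    and x: "snd ?x \<in> set (suffs (terminated (ws ! fst ?x)))"
    unfolding T_def sites_section by (auto split: if_splits)
  let ?D = "terminated (ws ! fst ?x)"
  have doc: "document_array T ! k = fst ?x + 1"
    using document_of_eq[of ?p ws] p k by (simp add: document_array_def T_def)
  have D: "documents T !\<^sub>1 (fst ?x + 1) = ?D"
    using lt unfolding T_def documents_concat_terminated by simp
  have rank: "rank (fst ?x + 1) (document_array T) (Suc k) = card {y \<in> set (suffs ?D). y \<le> snd ?x}"
  proof -
    have "{y. (fst ?x, y) \<in> set (sites T) \<and> y \<le> snd ?x} = {y \<in> set (suffs ?D). y \<le> snd ?x}"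
      using sec by blast
    then show ?thesis using rank_document_array[of "Suc k" ws] k by (simp add: T_def)
  qed
  have "ilcp T ! k = lcp_array ?D !\<^sub>1 card {y \<in> set (suffs ?D). y \<le> snd ?x}"
    using k doc D rank by (simp add: ilcp_def Let_def nth_append del: upt_Suc)
  also have "\<dots> = max_lcp (set (sites T)) ?x"
  proof -
    have "{y. (fst ?x, y) \<in> set (sites T) \<and> y < snd ?x} = {y \<in> set (suffs ?D). y < snd ?x}"
      using sec by blast
    then show ?thesis unfolding lcp_array_rank[OF x] max_lcp_def by simp
  qed
  finally show "ilcp T ! k = map (\<lambda>p. max_lcp (set (sites T)) (site T (p - 1))) (suffix_array T) ! k"
    using k by simp
qed (simp add: ilcp_def del: upt_Suc)

text \<open>\<open>xs\<close> lists the sites in suffix array order. As \<open>cut\<close> and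
  \<open>take\<close> are monotone, it is sorted by truncated suffixes across all documents, which
  puts equal ones next to each other.\<close>

lemma ilcp_sites:
  fixes ws :: "'a::linorder list list"
  defines "T \<equiv> concat (map terminated ws)"
  shows "\<exists>xs. mset xs = mset (sites T) \<and> ilcp T = map (max_lcp (set (sites T))) xs \<and>
    (\<forall>L. sorted (map (\<lambda>x. take L (snd x)) xs))"
proof (intro exI conjI allI)
  let ?xs = "map (\<lambda>p. site T (p - 1)) (suffix_array T)"
  show "ilcp T = map (max_lcp (set (sites T))) ?xs"
    unfolding T_def ilcp_eq by (simp add: o_def)
  have "mset (suffix_array T) = mset (map Suc [0..<length T])"
    by (rule set_eq_iff_mset_eq_distinct[THEN iffD1])
      (auto simp: distinct_map image_Suc_atLeastLessThan)
  then have "image_mset (\<lambda>p. site T (p - 1)) (mset (suffix_array T)) =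
      image_mset (\<lambda>p. site T (p - 1)) (mset (map Suc [0..<length T]))" by simp
  then show "mset ?xs = mset (sites T)"
    by (simp add: sites_def o_def image_mset.compositionality)
  show "sorted (map (\<lambda>x. take L (snd x)) ?xs)" for L
  proof -
    have "sorted_wrt (\<lambda>p q. take L (snd (site T (p - 1))) \<le> take L (snd (site T (q - 1)))) (suffix_array T)"
      by (rule sorted_wrt_mono_rel[OF _ sorted_suffix_array[of T]])
        (simp add: site_def take_mono cut_mono)
    then show ?thesis by (simp add: sorted_map o_def sorted_wrt_map)
  qed
qed

section \<open>The number of runs\<close>

lemma factorsE:
  assumes "f \<in> factors L S"
  obtains z where "f = take L (cut z)"
proof -
  obtain i where i: "i \<le> length S" "f = take L (drop i (map Some S @ [None]))"
    using assms by (auto simp: factors_def suffs_def less_Suc_eq_le simp del: upt_Suc)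
  have "cut (map Some w) = map Some w @ [None]" for w :: "'a list"
    by (induction w) auto
  then have "f = take L (cut (map Some (drop i S)))" using i by (simp add: drop_map)
  with that show ?thesis .
qed

lemma max_lcp_section_cong:
  assumes "\<And>y. (i, y) \<in> A \<longleftrightarrow> (j, y) \<in> B"
  shows "max_lcp A (i, x) = max_lcp B (j, x)"
  using assms by (simp add: max_lcp_def)

text \<open>The two smallest factors, the terminator alone and its successor, both have value 0, so one
  of the \<open>length S + 1\<close> blocks is saved.\<close>

lemma length_remdups_adj_factors:
  fixes S :: "'a::linorder list"
  assumes S: "S \<noteq> []" and L: "L \<ge> 1"
    and sorted: "sorted fs" and sub: "set fs \<subseteq> factors L S"
  shows "length (remdups_adj (map (\<lambda>f. max_lcp ({0} \<times> factors L S) (0, f)) fs)) \<le> length S"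
proof -
  let ?F = "factors L S"
  let ?v = "\<lambda>f. max_lcp ({0} \<times> ?F) (0, f)"
  have take_None: "take L [None] = [None :: 'a option]" using L by (cases L) auto
  have bot: "[None] \<le> f" if f: "f \<in> ?F" for f
  proof -
    obtain z where "f = take L (cut z)" using f by (rule factorsE)
    with take_mono[OF None_le_cut, of L z] show ?thesis by (simp add: take_None)
  qed
  have lcp_bot: "lcp [None] f = 0" if f: "f \<in> ?F" "f \<noteq> [None]" for f
  proof -
    obtain z where "f = take L (cut z)" using f(1) by (rule factorsE)
    with f(2) L show ?thesis by (cases z rule: documents.cases; cases L) auto
  qed
  have bot_in: "[None] \<in> ?F"
  proof -
    have "[None] \<in> set (suffs (map Some w @ [None]))" for w :: "'a list" by (induction w) auto
    from imageI[OF this, of "take L"] show ?thesis by (simp only: factors_def take_None)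
  qed
  define F' where "F' = ?F - {[None]}"
  have "F' \<noteq> {}"
  proof -
    obtain a w where aw: "S = a # w" using S by (cases S) auto
    have "take L (Some a # map Some w @ [None]) \<in> ?F" by (simp add: factors_def aw)
    moreover have "take L (Some a # map Some w @ [None]) \<noteq> [None]" using L by (cases L) auto
    ultimately show ?thesis by (auto simp: F'_def)
  qed
  moreover have finF: "finite F'" by (simp add: F'_def)
  ultimately have m_in: "Min F' \<in> F'" by (intro Min_in)
  define m where "m = Min F'"
  have m: "m \<in> ?F" "m \<noteq> [None]" "\<And>f. f \<in> ?F \<Longrightarrow> f \<noteq> [None] \<Longrightarrow> m \<le> f"
    using m_in Min_le[OF finF] by (auto simp: m_def F'_def)
  have v_bot: "?v [None] = 0"
    by (rule max_lcp_cases[of "{0} \<times> ?F" "(0, [None])"]) (use bot leD in auto)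
  have v_m: "?v m = 0"
  proof (rule max_lcp_cases[of "{0} \<times> ?F" "(0, m)"])
    fix y assume y: "(fst (0, m), y) \<in> {0} \<times> ?F" "y < snd (0, m)" "?v m = lcp y (snd (0, m))"
    then have "y = [None]" using m(3)[of y] by (auto dest: leD)
    then show ?thesis using lcp_bot[OF m(1,2)] y(3) by simp
  qed simp_all
  \<comment> \<open>\<open>h\<close> merges the terminator with its successor \<open>m\<close> among
    the factors. Both have value 0, so merging changes no entry, keeps the list sorted and saves a
    block.\<close>
  define h where "h = (\<lambda>f. if f = [None] then m else f)"
  have "map ?v fs = map ?v (map h fs)" using v_bot v_m by (simp add: h_def)
  then have "length (remdups_adj (map ?v fs)) \<le> length (remdups_adj (map h fs))"
    using length_remdups_adj_map[of ?v "map h fs"] by (simp only:)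
  also have "\<dots> = card (set (map h fs))"
  proof (rule length_remdups_adj_sorted)
    have mono: "h f \<le> h g" if "f \<in> set fs" "g \<in> set fs" "f \<le> g" for f g
      using that sub m(3) bot[of f] bot[of g] unfolding h_def by (auto dest: antisym)
    then show "sorted (map h fs)"
      unfolding sorted_map by (rule sorted_wrt_mono_rel[OF _ sorted])
  qed
  also have "\<dots> \<le> card F'"
    using sub m(1,2) finF by (intro card_mono) (auto simp: F'_def h_def)
  also have "\<dots> \<le> length S"
  proof -
    have "card ?F \<le> card (set (suffs (map Some S @ [None])))"
      unfolding factors_def by (rule card_image_le) simp
    also have "\<dots> \<le> Suc (length S)"
      using card_length[of "suffs (map Some S @ [None])"] by (simp add: suffs_def)
    finally show ?thesis using bot_in by (simp add: F'_def)
  qed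
  finally show ?thesis .
qed

text \<open>Entries that agree with the unedited collection have a value depending on the factor
  alone, so their bound is free of \<open>d\<close>. At most \<open>4 * s * (L + 1)\<close> entries
  disagree and each costs two blocks, hence the 8.\<close>

proposition num_runs_ilcp_le:
  fixes S :: "'a::linorder list"
  assumes S: "S \<noteq> []" and L: "L \<ge> 1"
    and no_repeat: "\<And>i j. i < j \<Longrightarrow> j + L \<le> length S \<Longrightarrow> take L (drop i S) \<noteq> take L (drop j S)"
    and edits: "(edit ^^ s) (copies d S) T"
  shows "num_runs (ilcp T) \<le> length S + 8 * s * (L + 1)"
proof -
  let ?U = "{..<d} \<times> factors L S"
  let ?g = "max_lcp (set (sites T))"
  define P where "P = (\<lambda>x. tag L x \<in> ?U \<and> ?g x = max_lcp ?U (tag L x))"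
  obtain ws where ws: "T = concat (map terminated ws)"
    using edits_terminated[OF edits] by blast
  obtain xs where xs: "mset xs = mset (sites T)" "ilcp T = map ?g xs"
    "\<And>L. sorted (map (\<lambda>x. take L (snd x)) xs)"
    using ilcp_sites[of ws] unfolding ws by blast
  have irregular: "length (filter (\<lambda>x. \<not> P x) xs) \<le> 4 * s * (L + 1)"
  proof -
    have U: "mset (tags L (copies d S)) = mset_set ?U"
      using no_repeat by (intro mset_tags_copies distinct_take_suffs)
    have "length (filter (\<lambda>x. \<not> P x) xs) = length (filter (\<lambda>x. \<not> P x) (sites T))"
      using xs(1) by (metis mset_filter size_mset)
    also have "\<dots> \<le> 3 * size (mset (tags L T) - mset_set ?U) + size (mset_set ?U - mset (tags L T))"
      unfolding P_def by (rule length_filter_irregular) simp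
    also have "\<dots> \<le> 3 * (s * (L + 1)) + s * (L + 1)"
      using edits_tags[OF edits, of L] unfolding U by (intro add_mono mult_le_mono2) auto
    finally show ?thesis by (simp add: algebra_simps)
  qed
  have regular: "length (remdups_adj (map ?g (filter P xs))) \<le> length S"
  proof -
    let ?fs = "map (\<lambda>x. take L (snd x)) (filter P xs)"
    \<comment> \<open>All documents have the same section \<open>factors L S\<close> in
      \<open>?U\<close>, so the document number may be replaced by 0.\<close>
    have "?g x = max_lcp ({0} \<times> factors L S) (0, take L (snd x))" if "P x" for x
    proof -
      have "?g x = max_lcp ?U (fst x, take L (snd x))" "fst x < d"
        using that by (cases x; simp add: P_def)+
      then show ?thesis
        using max_lcp_section_cong[of "fst x" ?U 0 "{0} \<times> factors L S"] by simp
    qed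
    then have "map ?g (filter P xs) = map (\<lambda>f. max_lcp ({0} \<times> factors L S) (0, f)) ?fs"
      by simp
    moreover have "sorted ?fs"
      using xs(3)[of L] unfolding sorted_map by (rule sorted_wrt_filter)
    moreover have "set ?fs \<subseteq> factors L S"
      by (force simp: P_def)
    ultimately show ?thesis
      using length_remdups_adj_factors[OF S L] by metis
  qed
  have "num_runs (ilcp T) \<le> length (remdups_adj (map ?g xs))"
    unfolding xs(2) by (rule num_runs_le)
  also have "\<dots> \<le> length (remdups_adj (map ?g (filter P xs))) + 2 * length (filter (\<lambda>x. \<not> P x) xs)"
    using length_remdups_adj_filter[of ?g xs P] by linarith
  finally show ?thesis using regular irregular by simp
qed

section \<open>Repeated factors of strongly mixing sources\<close>

context A2_source
begin

lemma measurable_determined: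
  fixes I :: "nat set"
  defines "N \<equiv> sigma (space M) (\<Union>k\<in>I. {X k -` A \<inter> space M | A. A \<in> UNIV})"
  shows "sets N = determined_events M X I" "space N = space M"
    "\<And>k. k \<in> I \<Longrightarrow> X k \<in> measurable N (count_space UNIV)"
proof -
  have sub: "(\<Union>k\<in>I. {X k -` A \<inter> space M | A. A \<in> UNIV}) \<subseteq> Pow (space M)" by auto
  show sets: "sets N = determined_events M X I" and space: "space N = space M"
    using sub by (simp_all add: N_def determined_events_def sets_measure_of space_measure_of)
  show "X k \<in> measurable N (count_space UNIV)" if "k \<in> I" for k
  proof (rule measurableI)
    fix A :: "'a set"
    have "X k -` A \<inter> space M \<in> (\<Union>k\<in>I. {X k -` A \<inter> space M | A. A \<in> UNIV})"
      using that by blast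
    then show "X k -` A \<inter> space N \<in> sets N"
      unfolding sets space determined_events_def by (rule sigma_sets.Basic)
  qed simp
qed

lemma eq_measurable:
  assumes [measurable]: "X k \<in> measurable N (count_space UNIV)" "X l \<in> measurable N (count_space UNIV)"
  shows "{\<omega> \<in> space N. X k \<omega> = X l \<omega>} \<in> sets N" "{\<omega> \<in> space N. X k \<omega> = a} \<in> sets N"
  by measurable

lemma match_measurable:
  fixes m :: nat
  assumes "\<And>t. t < m \<Longrightarrow> X (h t) \<in> measurable N (count_space UNIV)"
    and "\<And>t. t < m \<Longrightarrow> X (h' t) \<in> measurable N (count_space UNIV)"
  shows "{\<omega> \<in> space N. \<forall>t<m. X (h t) \<omega> = X (h' t) \<omega>} \<in> sets N"
proof -
  have "{\<omega> \<in> space N. \<forall>t\<in>{..<m}. X (h t) \<omega> = X (h' t) \<omega>} \<in> sets N"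
  proof (rule sets.sets_Collect_finite_All)
    fix t assume "t \<in> {..<m}"
    then have t: "t < m" by simp
    show "{\<omega> \<in> space N. X (h t) \<omega> = X (h' t) \<omega>} \<in> sets N"
      by (rule eq_measurable(1)[OF assms(1)[OF t] assms(2)[OF t]])
  qed simp
  then show ?thesis by (simp only: Ball_def lessThan_iff)
qed

section \<open>Stationarity and contraction\<close>

lemma prob_eq_stationary: "prob {\<omega> \<in> space M. X k \<omega> = a} = prob {\<omega> \<in> space M. X 0 \<omega> = a}"
proof (induction k)
  case (Suc k)
  have meas: "(\<lambda>\<omega> n. X (h n) \<omega>) \<in> measurable M seq_space" for h :: "nat \<Rightarrow> nat"
    using measurable_PiM_single'[of UNIV "\<lambda>n. X (h n)" M "\<lambda>_. count_space UNIV"] measurable_X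
    by (auto simp: PiE_def Pi_def extensional_def)
  have ev: "{x. x k = a} \<in> sets (seq_space :: (nat \<Rightarrow> 'a) measure)"
  proof -
    have "(\<lambda>x. x k) -` {a} \<inter> space (seq_space :: (nat \<Rightarrow> 'a) measure) \<in> sets seq_space"
      by (rule measurable_sets[OF measurable_component_singleton]) auto
    then show ?thesis by (simp add: space_PiM vimage_def)
  qed
  have "prob {\<omega> \<in> space M. X (h k) \<omega> = a} = measure (process_law M (\<lambda>n. X (h n))) {x. x k = a}"
    for h :: "nat \<Rightarrow> nat"
    unfolding process_law_def measure_distr[OF meas ev] by (simp add: vimage_def Int_def conj_commute)
  from this[of Suc] this[of "\<lambda>n. n"] show ?case
    using stationary Suc by (simp add: stationary_def)
qed simp

text \<open>A bound on the conditional probability of a symbol given the past at distance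
  \<open>g\<close>, multiplied out so that null events need no exception.\<close>

definition contracting :: "real \<Rightarrow> nat \<Rightarrow> bool" where
  "contracting c g \<longleftrightarrow> (\<forall>m k a. \<forall>A\<in>determined_events M X {..m}. m + g \<le> k \<longrightarrow>
     prob (A \<inter> {\<omega> \<in> space M. X k \<omega> = a}) \<le> c * prob A)"

lemma contractingD:
  "contracting c g \<Longrightarrow> A \<in> determined_events M X {..m} \<Longrightarrow> m + g \<le> k \<Longrightarrow>
    prob (A \<inter> {\<omega> \<in> space M. X k \<omega> = a}) \<le> c * prob A"
  unfolding contracting_def by blast

text \<open>With \<open>q\<close> < 1 the largest probability of a single symbol, mixing gives the
  factor \<open>(1 + \<alpha> g) * q\<close>, which stays below 1 once the gap makes
  \<open>\<alpha> g\<close> small.\<close>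

lemma mixing_contraction:
  assumes nonconstant: "\<not> (\<exists>a. AE \<omega> in M. X 0 \<omega> = a)"
  shows "\<exists>c g. 0 < c \<and> c < 1 \<and> g \<ge> 1 \<and> contracting c g"
proof -
  define q where "q = Max (range (\<lambda>a. prob {\<omega> \<in> space M. X 0 \<omega> = a}))"
  have q_ge: "prob {\<omega> \<in> space M. X 0 \<omega> = a} \<le> q" for a
    unfolding q_def by (rule Max_ge) auto
  have "q \<in> range (\<lambda>a. prob {\<omega> \<in> space M. X 0 \<omega> = a})"
    unfolding q_def by (rule Max_in) auto
  then obtain a where a: "q = prob {\<omega> \<in> space M. X 0 \<omega> = a}" by blast
  have ev: "{\<omega> \<in> space M. X k \<omega> = a} \<in> events" for a k
    by (rule eq_measurable(2)) (rule measurable_X)+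
  have "q \<noteq> 1" using nonconstant prob_Collect_eq_1[OF ev] unfolding a by blast
  then have q1: "q < 1" using prob_le_1 unfolding a by (metis order_le_less)
  have q0: "0 \<le> q" by (simp add: a)
  obtain \<alpha> :: "nat \<Rightarrow> real" where \<alpha>: "\<alpha> \<longlonglongrightarrow> 0"
    and mix: "\<And>m g A B. A \<in> determined_events M X {..m} \<Longrightarrow> B \<in> determined_events M X {m + g..} \<Longrightarrow>
      g \<ge> 1 \<Longrightarrow> prob (A \<inter> B) \<le> (1 + \<alpha> g) * prob A * prob B"
    using strongly_mixing unfolding strongly_mixing_def by blast
  have "eventually (\<lambda>g. \<bar>\<alpha> g\<bar> < (1 - q) / 2) sequentially"
    using tendstoD[OF \<alpha>, of "(1 - q) / 2"] q1 by (simp add: dist_real_def)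
  then obtain g0 where g0: "\<And>g. g \<ge> g0 \<Longrightarrow> \<bar>\<alpha> g\<bar> < (1 - q) / 2"
    by (auto simp: eventually_sequentially)
  define g where "g = max g0 1"
  have \<alpha>g: "\<bar>\<alpha> g\<bar> < (1 - q) / 2" by (rule g0) (simp add: g_def)
  \<comment> \<open>The midpoint of \<open>q\<close> and 1;
    \<open>(1 + (1 - q) / 2) * q <= c\<close> amounts to
    \<open>0 <= (1 - q) * (1 - q)\<close>.\<close>
  define c where "c = (1 + q) / 2"
  have "contracting c g"
    unfolding contracting_def
  proof (intro allI ballI impI)
    fix m k a A assume A: "A \<in> determined_events M X {..m}" and k: "m + g \<le> k"
    have "{\<omega> \<in> space M. X k \<omega> = a} \<in> determined_events M X {m + g..}"
    proof -
      let ?N = "sigma (space M) (\<Union>k\<in>{m + g..}. {X k -` A \<inter> space M | A. A \<in> UNIV})"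
      note N = measurable_determined[where I = "{m + g..}"]
      have "{\<omega> \<in> space ?N. X k \<omega> = a} \<in> sets ?N"
        by (rule eq_measurable(2); rule N(3)) (use k in auto)
      then show ?thesis unfolding N(1,2) .
    qed
    from mix[OF A this] have "prob (A \<inter> {\<omega> \<in> space M. X k \<omega> = a}) \<le>
        (1 + \<alpha> g) * prob A * prob {\<omega> \<in> space M. X k \<omega> = a}" by (simp add: g_def)
    also have "\<dots> = (1 + \<alpha> g) * prob {\<omega> \<in> space M. X 0 \<omega> = a} * prob A"
      by (simp add: prob_eq_stationary[of k])
    also have "\<dots> \<le> c * prob A"
    proof (rule mult_right_mono)
      have "(1 + \<alpha> g) * prob {\<omega> \<in> space M. X 0 \<omega> = a} \<le> (1 + (1 - q) / 2) * q"
        using \<alpha>g q_ge[of a] q1 by (intro mult_mono) auto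
      also have "\<dots> \<le> c"
      proof -
        have "0 \<le> (1 - q) * (1 - q) / 2" using q1 by simp
        then show ?thesis by (simp add: c_def field_simps)
      qed
      finally show "(1 + \<alpha> g) * prob {\<omega> \<in> space M. X 0 \<omega> = a} \<le> c" .
    qed simp
    finally show "prob (A \<inter> {\<omega> \<in> space M. X k \<omega> = a}) \<le> c * prob A" .
  qed
  moreover have "0 < c" "c < 1" "g \<ge> 1" using q0 q1 by (simp_all add: c_def g_def)
  ultimately show ?thesis by blast
qed

text \<open>Split by the value \<open>a\<close> of \<open>X (i + m * g)\<close>. Together with the
  earlier matches it is determined at least \<open>g\<close> steps before time
  \<open>j + m * g\<close>, so each sampled position gains a factor \<open>c\<close>, and the parts
  sum up to the event for \<open>m\<close>.\<close>

lemma prob_sparse_match_le: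
  assumes c: "0 < c"
    and contraction: "contracting c g"
    and ij: "i + g \<le> j"
  shows "prob {\<omega> \<in> space M. \<forall>t<m. X (i + t * g) \<omega> = X (j + t * g) \<omega>} \<le> c ^ m"
proof (induction m)
  case (Suc m)
  let ?E = "{\<omega> \<in> space M. \<forall>t<m. X (i + t * g) \<omega> = X (j + t * g) \<omega>}"
  let ?A = "\<lambda>a. ?E \<inter> {\<omega> \<in> space M. X (i + m * g) \<omega> = a}"
  let ?B = "\<lambda>a. {\<omega> \<in> space M. X (j + m * g) \<omega> = a}"
  have ev: "?E \<in> events" "{\<omega> \<in> space M. X k \<omega> = a} \<in> events" for a k
    by (rule match_measurable eq_measurable(2); rule measurable_X)+
  have A: "?A a \<in> determined_events M X {..j + m * g - g}" for a
  proof -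
    let ?l = "j + m * g - g"
    let ?N = "sigma (space M) (\<Union>k\<in>{..?l}. {X k -` A \<inter> space M | A. A \<in> UNIV})"
    note N = measurable_determined[where I = "{..?l}"]
    \<comment> \<open>The spacing \<open>g\<close> of the samples and \<open>i + g \<le> j\<close>
      keep every time consulted so far at least \<open>g\<close> before
      \<open>j + m * g\<close>.\<close>
    have le: "i + m * g \<le> ?l" "i + t * g \<le> ?l" "j + t * g \<le> ?l" if "t < m" for t
    proof -
      have "Suc t * g \<le> m * g" using that by (intro mult_le_mono1) simp
      then show "i + m * g \<le> ?l" "i + t * g \<le> ?l" "j + t * g \<le> ?l" using ij by simp_all
    qed
    have le': "i + m * g \<le> ?l" using ij by simp
    have "{\<omega> \<in> space ?N. \<forall>t<m. X (i + t * g) \<omega> = X (j + t * g) \<omega>} \<in> sets ?N"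
      by (rule match_measurable; rule N(3)) (use le in auto)
    moreover have "{\<omega> \<in> space ?N. X (i + m * g) \<omega> = a} \<in> sets ?N"
      by (rule eq_measurable(2); rule N(3)) (use le' in auto)
    ultimately have "{\<omega> \<in> space ?N. \<forall>t<m. X (i + t * g) \<omega> = X (j + t * g) \<omega>} \<inter>
        {\<omega> \<in> space ?N. X (i + m * g) \<omega> = a} \<in> sets ?N"
      by (rule sets.Int)
    then show ?thesis unfolding N(1,2) .
  qed
  have disj: "disjoint_family_on (\<lambda>a. E \<inter> {\<omega> \<in> space M. f \<omega> = a}) UNIV" for E and f :: "'w \<Rightarrow> 'a"
    by (auto simp: disjoint_family_on_def)
  have union: "(\<Union>a\<in>UNIV. {\<omega> \<in> space M. Q \<omega>} \<inter> {\<omega> \<in> space M. f \<omega> = a}) = {\<omega> \<in> space M. Q \<omega>}"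
    for Q and f :: "'w \<Rightarrow> 'a"
    by auto
  have split: "{\<omega> \<in> space M. f \<omega> = h \<omega> \<and> Q \<omega>} = (\<Union>a\<in>UNIV. {\<omega> \<in> space M. Q \<omega>} \<inter>
      {\<omega> \<in> space M. f \<omega> = a} \<inter> {\<omega> \<in> space M. h \<omega> = a})" for f h :: "'w \<Rightarrow> 'a" and Q
    by auto
  have "{\<omega> \<in> space M. \<forall>t<Suc m. X (i + t * g) \<omega> = X (j + t * g) \<omega>} = (\<Union>a\<in>UNIV. ?A a \<inter> ?B a)"
    unfolding All_less_Suc by (rule split)
  then have "prob {\<omega> \<in> space M. \<forall>t<Suc m. X (i + t * g) \<omega> = X (j + t * g) \<omega>} =
      prob (\<Union>a\<in>UNIV. ?A a \<inter> ?B a)"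
    by (rule arg_cong)
  also have "\<dots> \<le> (\<Sum>a\<in>UNIV. prob (?A a \<inter> ?B a))"
    by (intro finite_measure_subadditive_finite image_subsetI sets.Int ev finite)
  also have "\<dots> \<le> (\<Sum>a\<in>UNIV. c * prob (?A a))"
    using ij by (intro sum_mono contractingD[OF contraction A]) simp
  also have "\<dots> = c * (\<Sum>a\<in>UNIV. prob (?A a))" by (rule sum_distrib_left[symmetric])
  also have "(\<Sum>a\<in>UNIV. prob (?A a)) = prob ?E"
  proof -
    have "(\<Sum>a\<in>UNIV. prob (?A a)) = prob (\<Union>a\<in>UNIV. ?A a)"
      by (intro finite_measure_finite_Union[symmetric] image_subsetI sets.Int ev finite disj)
    then show ?thesis unfolding union .
  qed
  also have "c * prob ?E \<le> c * c ^ m" using Suc.IH c by (rule mult_left_mono[OF _ less_imp_le])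
  finally show ?case unfolding power_Suc .
qed (simp add: prob_space)

text \<open>Sampling \<open>m\<close> positions at distance \<open>g\<close> takes
  \<open>g * m\<close> symbols; the further \<open>g * g\<close> leave room to follow a period
  shorter than \<open>g\<close> for \<open>g\<close> steps.\<close>

lemma prob_match_le:
  assumes c: "0 < c" and g: "g \<ge> 1"
    and contraction: "contracting c g"
    and ij: "i < j"
  shows "prob {\<omega> \<in> space M. \<forall>t<g * m + g * g. X (i + t) \<omega> = X (j + t) \<omega>} \<le> c ^ m"
proof -
  \<comment> \<open>If the two windows are closer than \<open>g\<close>, a match is a period \<open>j - i\<close>, and its multiple
    \<open>g * (j - i)\<close> provides the distance that mixing needs.\<close>
  define j' where "j' = (if i + g \<le> j then j else i + g * (j - i))"
  have j': "i + g \<le> j'" using ij g by (auto simp: j'_def)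
  let ?D = "{\<omega> \<in> space M. \<forall>t<g * m + g * g. X (i + t) \<omega> = X (j + t) \<omega>}"
  let ?E = "{\<omega> \<in> space M. \<forall>t<m. X (i + t * g) \<omega> = X (j' + t * g) \<omega>}"
  have "?D \<subseteq> ?E"
  proof clarify
    fix \<omega> t assume D: "\<forall>t<g * m + g * g. X (i + t) \<omega> = X (j + t) \<omega>" and t: "t < m"
    have tg: "t * g < g * m" using t g by (simp add: mult.commute)
    show "X (i + t * g) \<omega> = X (j' + t * g) \<omega>"
    proof (cases "i + g \<le> j")
      case True
      have "t * g < g * m + g * g" using tg by (rule trans_less_add1)
      with D have "X (i + t * g) \<omega> = X (j + t * g) \<omega>" by blast
      with True show ?thesis by (simp add: j'_def)
    next
      case False
      have "X (i + t * g) \<omega> = X (i + n * (j - i) + t * g) \<omega>" if "n \<le> g" for n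
        using that
      proof (induction n)
        case (Suc n)
        have "n * (j - i) \<le> g * g" using Suc.prems False by (intro mult_le_mono) auto
        then have "n * (j - i) + t * g < g * m + g * g" using tg by linarith
        then have "X (i + (n * (j - i) + t * g)) \<omega> = X (j + (n * (j - i) + t * g)) \<omega>" using D by blast
        moreover have "i + Suc n * (j - i) + t * g = j + (n * (j - i) + t * g)" using ij by simp
        ultimately show ?case using Suc by (simp add: add.assoc)
      qed simp
      from this[of g] show ?thesis using False by (simp add: j'_def algebra_simps)
    qed
  qed
  moreover have "?E \<in> events"
    by (rule match_measurable) (rule measurable_X)+
  ultimately have "prob ?D \<le> prob ?E" by (rule finite_measure_mono)
  also have "\<dots> \<le> c ^ m" by (rule prob_sparse_match_le[OF c contraction j'])
  finally show ?thesis .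
qed

text \<open>A union bound over at most \<open>r * r\<close> pairs of windows inside the prefix,
  overlapping windows included.\<close>

lemma prob_repeat_le:
  assumes c: "0 < c" and g: "g \<ge> 1"
    and contraction: "contracting c g"
  defines "L \<equiv> \<lambda>m. g * m + g * g"
  shows "prob {\<omega> \<in> space M. \<exists>i j. i < j \<and> j + L m \<le> r \<and>
      take (L m) (drop i (source_prefix X r \<omega>)) = take (L m) (drop j (source_prefix X r \<omega>))}
    \<le> real r ^ 2 * c ^ m"
proof -
  let ?I = "{(i, j). i < j \<and> j + L m \<le> r}"
  let ?D = "\<lambda>(i, j). {\<omega> \<in> space M. \<forall>t<L m. X (i + t) \<omega> = X (j + t) \<omega>}"
  have L: "L m \<ge> 1" using g by (simp add: L_def Suc_le_eq)
  have sub: "?I \<subseteq> {..<r} \<times> {..<r}" using L by auto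
  then have fin: "finite ?I" by (rule finite_subset) simp
  have "take l (drop i (source_prefix X r \<omega>)) = map (\<lambda>t. X (i + t) \<omega>) [0..<l]"
    if "i + l \<le> r" for i l \<omega>
    using that by (intro nth_equalityI) (auto simp: source_prefix_def)
  then have match: "take (L m) (drop i (source_prefix X r \<omega>)) = take (L m) (drop j (source_prefix X r \<omega>)) \<longleftrightarrow>
      (\<forall>t<L m. X (i + t) \<omega> = X (j + t) \<omega>)" if "i < j" "j + L m \<le> r" for i j \<omega>
    using that by (simp add: Ball_def)
  have "{\<omega> \<in> space M. \<exists>i j. i < j \<and> j + L m \<le> r \<and>
      take (L m) (drop i (source_prefix X r \<omega>)) = take (L m) (drop j (source_prefix X r \<omega>))} =
      (\<Union>p\<in>?I. ?D p)"
  proof (intro set_eqI iffI)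
    fix \<omega> assume "\<omega> \<in> (\<Union>p\<in>?I. ?D p)"
    then obtain p where p: "p \<in> ?I" "\<omega> \<in> ?D p" by (rule UN_E)
    obtain i j where pij: "p = (i, j)" by force
    note p = p[unfolded pij case_prod_conv mem_Collect_eq]
    have ij: "i < j" "j + L m \<le> r" using p(1) by simp_all
    show "\<omega> \<in> {\<omega> \<in> space M. \<exists>i j. i < j \<and> j + L m \<le> r \<and>
      take (L m) (drop i (source_prefix X r \<omega>)) = take (L m) (drop j (source_prefix X r \<omega>))}"
      by (intro CollectI conjI exI[of _ i] exI[of _ j] conjunct1[OF p(2)] ij
          match[OF ij, THEN iffD2] conjunct2[OF p(2)])
  next
    fix \<omega> assume "\<omega> \<in> {\<omega> \<in> space M. \<exists>i j. i < j \<and> j + L m \<le> r \<and>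
      take (L m) (drop i (source_prefix X r \<omega>)) = take (L m) (drop j (source_prefix X r \<omega>))}"
    then obtain i j where "\<omega> \<in> space M" and ij: "i < j" "j + L m \<le> r"
      and "take (L m) (drop i (source_prefix X r \<omega>)) = take (L m) (drop j (source_prefix X r \<omega>))"
      by blast
    then have "\<omega> \<in> ?D (i, j)" using match[OF ij] by (simp only: mem_Collect_eq case_prod_conv)
    moreover have "(i, j) \<in> ?I" using ij by simp
    ultimately show "\<omega> \<in> (\<Union>p\<in>?I. ?D p)" by (rule UN_I[rotated])
  qed
  then have "prob {\<omega> \<in> space M. \<exists>i j. i < j \<and> j + L m \<le> r \<and>
      take (L m) (drop i (source_prefix X r \<omega>)) = take (L m) (drop j (source_prefix X r \<omega>))} =
      prob (\<Union>p\<in>?I. ?D p)"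
    by (rule arg_cong)
  also have "\<dots> \<le> (\<Sum>p\<in>?I. prob (?D p))"
  proof (rule finite_measure_subadditive_finite[OF fin], rule image_subsetI)
    fix p :: "nat \<times> nat"
    obtain i j where p: "p = (i, j)" by force
    have "{\<omega> \<in> space M. \<forall>t<L m. X (i + t) \<omega> = X (j + t) \<omega>} \<in> events"
      by (rule match_measurable) (rule measurable_X)+
    then show "?D p \<in> events" by (simp only: case_prod_conv p)
  qed
  also have "\<dots> \<le> (\<Sum>p\<in>?I. c ^ m)"
  proof (rule sum_mono)
    fix p assume "p \<in> ?I"
    then obtain i j where p: "p = (i, j)" and "i < j" by auto
    have "prob {\<omega> \<in> space M. \<forall>t<g * m + g * g. X (i + t) \<omega> = X (j + t) \<omega>} \<le> c ^ m"
      by (rule prob_match_le[OF c g contraction \<open>i < j\<close>])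
    then show "prob (?D p) \<le> c ^ m" by (simp only: L_def case_prod_conv p)
  qed
  also have "\<dots> = real (card ?I) * c ^ m" by (rule sum_constant)
  also have "\<dots> \<le> real r ^ 2 * c ^ m"
  proof (rule mult_right_mono)
    have "card ?I \<le> card ({..<r} \<times> {..<r})" by (rule card_mono[OF _ sub]) simp
    then have "card ?I \<le> r * r" by (simp only: card_cartesian_product card_lessThan)
    then show "real (card ?I) \<le> real r ^ 2"
      unfolding power2_eq_square of_nat_mult[symmetric] of_nat_le_iff .
  qed (use c in simp)
  finally show ?thesis .
qed

end

section \<open>Tail suprema and the choice of constants\<close>

lemma asymptotically_almost_surelyI:
  assumes M: "prob_space M"
    and le: "\<And>N. N \<ge> 2 \<Longrightarrow> measure M {\<omega> \<in> space M. \<not> E N \<omega>} \<le> 1 / real N"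
  shows "asymptotically_almost_surely M E"
  unfolding asymptotically_almost_surely_def
proof (rule tendsto_sandwich)
  let ?p = "\<lambda>N. measure M {\<omega> \<in> space M. \<not> E N \<omega>}"
  have "bdd_above (?p ` {n<..})" for n
    by (rule bdd_aboveI2[of _ _ 1]) (rule prob_space.prob_le_1[OF M])
  then have "0 \<le> (SUP N\<in>{n<..}. ?p N)" for n
    by (rule cSUP_upper2[of _ _ "Suc n"]) (simp_all only: greaterThan_iff lessI measure_nonneg)
  then show "eventually (\<lambda>n. 0 \<le> (SUP N\<in>{n<..}. ?p N)) sequentially"
    by (rule always_eventually[OF allI])
  \<comment> \<open>The bound decreases in \<open>N\<close>, so the first index of the tail decides;
    \<open>n \<ge> 1\<close> ensures \<open>N \<ge> 2\<close>.\<close>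
  have "(SUP N\<in>{n<..}. ?p N) \<le> 1 / real (Suc n)" if "n \<ge> 1" for n
  proof (rule cSUP_least)
    fix N assume "N \<in> {n<..}"
    then have N: "Suc n \<le> N" by simp
    then have "?p N \<le> 1 / real N" using that by (intro le) linarith
    also have "\<dots> \<le> 1 / real (Suc n)" using N by (intro divide_left_mono) auto
    finally show "?p N \<le> 1 / real (Suc n)" .
  qed (rule greaterThan_non_empty)
  then show "eventually (\<lambda>n. (SUP N\<in>{n<..}. ?p N) \<le> 1 / real (Suc n)) sequentially"
    by (rule eventually_sequentiallyI)
  show "(\<lambda>n. 1 / real (Suc n)) \<longlonglongrightarrow> 0"
    using LIMSEQ_inverse_real_of_nat by (simp add: inverse_eq_divide)
qed (rule tendsto_const)

text \<open>\<open>C\<close> depends only on the source, while \<open>d\<close>, \<open>s\<close>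
  and \<open>T\<close> are quantified inside the event, so the edits may depend on the outcome.
  Nonconstancy makes repeats rare: in a constant source all windows of equal length agree almost
  surely.\<close>

theorem lemma2:
  fixes M :: "'w measure" and X :: "nat \<Rightarrow> 'w \<Rightarrow> 'a::{finite, linorder}"
  assumes source: "A2_source M X"
    and nonconstant: "\<not> (\<exists>a. AE \<omega> in M. X 0 \<omega> = a)"
  shows "\<exists>C::real. asymptotically_almost_surely M (\<lambda>r \<omega>.
           \<forall>d s T. d \<ge> 1 \<longrightarrow> (edit ^^ s) (copies d (source_prefix X r \<omega>)) T \<longrightarrow>
             real (num_runs (ilcp T)) \<le> real r + C * (real s * log 2 (real (r + s))))"
proof -
  interpret A2_source M X by (rule source)
  obtain c :: real and g where c: "0 < c" "c < 1" and g: "g \<ge> 1"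
    and contraction: "contracting c g"
    using mixing_contraction[OF nonconstant] by blast
  \<comment> \<open>Makes \<open>c ^ m r\<close> at most \<open>1 / r ^ 3\<close>: two powers of
    \<open>r\<close> are spent on the pairs of positions and the third leaves
    \<open>1 / r\<close>.\<close>
  define b where "b = 3 / - ln c"
  have lnc: "ln c < 0" using c by simp
  have b: "b > 0" using lnc by (simp add: b_def divide_pos_neg)
  define m where "m = (\<lambda>r::nat. nat \<lceil>b * ln (real r)\<rceil>)"
  define L where "L = (\<lambda>r. g * m r + g * g)"
  \<comment> \<open>Collects the terms of \<open>L r + 1\<close>; the rounding in \<open>m\<close>
    and the constants are absorbed by \<open>1 \<le> log 2 (real r)\<close>, valid for
    \<open>r \<ge> 2\<close>.\<close>
  define K where "K = real g * (b + 1) + real (g * g) + 1"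
  have m_le: "real (m r) \<le> b * ln (real r) + 1" and m_ge: "b * ln (real r) \<le> real (m r)"
    if "r \<ge> 2" for r
  proof -
    have "0 \<le> b * ln (real r)" using that b by simp
    then show "real (m r) \<le> b * ln (real r) + 1" "b * ln (real r) \<le> real (m r)"
      unfolding m_def by linarith+
  qed
  have power_le: "real r ^ 2 * c ^ m r \<le> 1 / real r" if r: "r \<ge> 2" for r
  proof -
    have "c ^ m r = exp (real (m r) * ln c)" using c by (simp add: exp_of_nat_mult)
    also have "\<dots> \<le> exp (b * ln (real r) * ln c)"
      using m_ge[OF r] lnc by (intro exp_le_cancel_iff[THEN iffD2] mult_right_mono_neg) auto
    also have "b * ln (real r) * ln c = - (real 3 * ln (real r))"
      using lnc by (simp add: b_def)
    also have "exp \<dots> = 1 / real r ^ 3"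
      using r by (simp only: exp_minus exp_of_nat_mult) (simp add: inverse_eq_divide)
    finally have "real r ^ 2 * c ^ m r \<le> real r ^ 2 * (1 / real r ^ 3)"
      by (rule mult_left_mono) simp
    also have "\<dots> = 1 / real r" using r by (simp add: power2_eq_square power3_eq_cube)
    finally show ?thesis .
  qed
  have L_le: "real (L r + 1) \<le> K * log 2 (real (r + s))" if r: "r \<ge> 2" for r s
  proof -
    have ln2: "ln (2::real) \<le> 1" using ln_le_minus_one[of "2::real"] by simp
    have log1: "1 \<le> log 2 (real r)" using r by (simp add: le_log_iff)
    have ln_le: "ln (real r) \<le> log 2 (real r)"
      using r ln2 by (simp add: log_def pos_le_divide_eq mult_left_le)
    have "real (m r) \<le> b * log 2 (real r) + 1"
      using m_le[OF r] mult_left_mono[OF ln_le, of b] b by linarith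
    also have "\<dots> \<le> (b + 1) * log 2 (real r)" using log1 by (simp add: algebra_simps)
    finally have "real g * real (m r) \<le> real g * ((b + 1) * log 2 (real r))"
      by (rule mult_left_mono) simp
    moreover have "real (g * g) + 1 \<le> (real (g * g) + 1) * log 2 (real r)"
      using mult_left_mono[OF log1, of "real (g * g) + 1"] by simp
    ultimately have "real (L r + 1) \<le> K * log 2 (real r)"
      by (simp add: L_def K_def algebra_simps)
    also have "\<dots> \<le> K * log 2 (real (r + s))"
      using r b by (intro mult_left_mono) (auto simp: K_def)
    finally show ?thesis .
  qed
  let ?E = "\<lambda>r \<omega>. \<forall>d s T. d \<ge> 1 \<longrightarrow> (edit ^^ s) (copies d (source_prefix X r \<omega>)) T \<longrightarrow>
             real (num_runs (ilcp T)) \<le> real r + 8 * K * (real s * log 2 (real (r + s)))"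
  let ?R = "\<lambda>r S. \<exists>i j. i < j \<and> j + L r \<le> r \<and> take (L r) (drop i S) = take (L r) (drop j S)"
  have runs: "?E r \<omega>" if r: "r \<ge> 2" and no_repeat: "\<not> ?R r (source_prefix X r \<omega>)" for r \<omega>
  proof (intro allI impI)
    fix d s T assume edits: "(edit ^^ s) (copies d (source_prefix X r \<omega>)) T"
    have len: "length (source_prefix X r \<omega>) = r" by (simp add: source_prefix_def)
    have "source_prefix X r \<omega> \<noteq> []" "L r \<ge> 1"
      using r g len by (auto simp: L_def Suc_le_eq)
    from num_runs_ilcp_le[OF this _ edits] no_repeat
    have "num_runs (ilcp T) \<le> r + 8 * s * (L r + 1)" unfolding len by blast
    then have "real (num_runs (ilcp T)) \<le> real (r + 8 * s * (L r + 1))"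
      by (rule of_nat_mono)
    also have "\<dots> = real r + 8 * real s * real (L r + 1)" by (simp add: algebra_simps)
    also have "\<dots> \<le> real r + 8 * real s * (K * log 2 (real (r + s)))"
      by (intro add_left_mono mult_left_mono L_le[OF r]) simp
    finally show "real (num_runs (ilcp T)) \<le> real r + 8 * K * (real s * log 2 (real (r + s)))"
      by (simp add: algebra_simps)
  qed
  have "measure M {\<omega> \<in> space M. \<not> ?E r \<omega>} \<le> 1 / real r" if r: "r \<ge> 2" for r
  proof -
    have "measure M {\<omega> \<in> space M. \<not> ?E r \<omega>} \<le> prob {\<omega> \<in> space M. ?R r (source_prefix X r \<omega>)}"
    proof (rule finite_measure_mono)
      show "{\<omega> \<in> space M. \<not> ?E r \<omega>} \<subseteq> {\<omega> \<in> space M. ?R r (source_prefix X r \<omega>)}"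
        using runs[OF r] by blast
    qed (rule prefix_event_measurable)
    also have "\<dots> \<le> real r ^ 2 * c ^ m r"
      unfolding L_def by (rule prob_repeat_le[OF c(1) g contraction])
    also have "\<dots> \<le> 1 / real r" by (rule power_le[OF r])
    finally show ?thesis .
  qed
  then have "asymptotically_almost_surely M ?E"
    by (rule asymptotically_almost_surelyI[OF prob_space_axioms])
  then show ?thesis by (rule exI[of _ "8 * K"])
qed

end
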